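(* Let $\varepsilon>0$, let $N\ge1$ and $K\ge 2$ be integers, let $f:[0,1]\to\mathbb{R}$, and let $T$ be the quantized tensor representation of $f$ on $\mathcal{D}_K$. In the rank-revealing construction (described in the context), let each SVD truncation rank $r_k$ ($k=2,\dots,K-1$) be chosen as small as possible such that the Frobenius norm error of the truncation is at most $\varepsilon\sqrt{2^k}$. Let $S$ denote the matrix product state furnished by the construction. Then the total error is bounded as $$\|T-S\|_2\le E_{1,N}[f]+(K-2)\,\Lambda_N\,\varepsilon,$$ where $\Lambda_N$ is the Lebesgue constant of $(N+1)$-point Chebyshev-Lobatto interpolation, which is in particular bounded by $$\Lambda_N\le 1+\frac{2}{\pi}\log(N+1).$$
   Context: Chebyshev-Lobatto grid on $[0,1]$ (with $N$ fixed and suppressed): $c^\alpha=c_N^\alpha=\frac{\cos(\pi\alpha/N)+1}{2}$, $\alpha=0,\dots,N$; $P^\alpha=P_N^\alpha$ is the Lagrange basis polynomial of degree $N$ with $P^\alpha(c^\beta)=\delta^{\alpha\beta}$. Lebesgue constant: $\Lambda_N=\sup_{x\in[0,1]}\sum_{\alpha=0}^N|P^\alpha(x)|$. Cores: for $\alpha,\beta\in\{0,\dots,N\}$, $\sigma\in\{0,1\}$, $A_L^{1,\beta}(\sigma)=f\left(\frac{\sigma+c^\beta}{2}\right)$, $A^{\alpha\beta}(\sigma)=P^\alpha\left(\frac{\sigma+c^\beta}{2}\right)$, $A_R^{\alpha,1}(\sigma)=P^\alpha\left(\frac{\sigma}{2}\right)$. Rank-revealing construction. (1) Set $r_0=1$.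 View $A_L$ as a $2\times(N+1)$ matrix (rows indexed by $\sigma$) and factor it exactly (e.g. by QR) as $A_L=U_1R_1$, where $U_1$ is a $2\times r_1$ matrix with orthonormal columns and $R_1$ is $r_1\times(N+1)$. (2) For $p=1,\dots,K-2$: given $R_p\in\mathbb{R}^{r_p\times(N+1)}$, form the tensor $B_p\in\mathbb{R}^{2\times r_p\times(N+1)}$ by $B_p(\sigma)=R_pA(\sigma)$; view $B_p$ as a $2r_p\times(N+1)$ matrix with row index $(\sigma,\alpha)$; take a truncated SVD keeping the $r_{p+1}$ largest singular values, $B_p\approx U_{p+1}\Sigma_{p+1}V_{p+1}^\top$, where $U_{p+1}\in\mathbb{R}^{2r_p\times r_{p+1}}$ and $V_{p+1}\in\mathbb{R}^{(N+1)\times r_{p+1}}$ have orthonormal columns; set $R_{p+1}=\Sigma_{p+1}V_{p+1}^\top$. The Frobenius norm error of this truncation is $\|B_p-U_{p+1}\Sigma_{p+1}V_{p+1}^\top\|_F$, with tolerance $\varepsilon\sqrt{2^{p+1}}$. Each $U_k$ is viewed as a core with matrices $U_k(\sigma)\in\mathbb{R}^{r_{k-1}\times r_k}$, $\sigma\in\{0,1\}$. (3) Output $S(\sigma_1,\dots,\sigma_K)=U_1(\sigma_1)\cdots U_{K-1}(\sigma_{K-1})\,R_{K-1}\,A_R(\sigma_K)$, with no further truncation. Dyadic grid: $\mathcal{D}_K=(2^{-K}\mathbb{Z})\cap[0,1)$; the quantized tensor representation of $f$ on $\mathcal{D}_K$ is $T:\{0,1\}^K\to\mathbb{R}$, $T(\sigma_1,\dots,\sigma_K)=f\left(\sum_{k=1}^K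 2^{-k}\sigma_k\right)$. Tensor norm (normalized): $\|S\|_2=\sqrt{2^{-K}\sum_{\sigma\in\{0,1\}^K}|S(\sigma)|^2}$. $\|\cdot\|_F$ is the unnormalized Frobenius (Euclidean) norm. Interpolation error: $E_{m,N}[f]=\max_{u\in[0,1-2^{-m}],\,v\in[0,1]}\left|f(u+2^{-m}v)-\sum_{\alpha=0}^N f(u+2^{-m}c_N^\alpha)P_N^\alpha(v)\right|$ (maximum understood as a supremum, possibly $+\infty$, if not attained); here $m=1$. *)

theory Defs
  imports "HOL-Analysis.Analysis" "HOL-Computational_Algebra.Polynomial"
    "Jordan_Normal_Form.Matrix"
begin

definition cheb_node :: "nat \<Rightarrow> nat \<Rightarrow> real" where
  "cheb_node N \<alpha> = (cos (pi * real \<alpha> / real N) + 1) / 2"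

definition cheb_basis :: "nat \<Rightarrow> nat \<Rightarrow> real poly" where
  "cheb_basis N \<alpha> = (\<Prod>\<beta>\<in>{0..N} - {\<alpha>}.
     Polynomial.smult (1 / (cheb_node N \<alpha> - cheb_node N \<beta>)) [:- cheb_node N \<beta>, 1:])"

lemma cheb_node_inj:
  assumes "N \<ge> 1" "\<alpha> \<le> N" "\<beta> \<le> N" "cheb_node N \<alpha> = cheb_node N \<beta>"
  shows "\<alpha> = \<beta>"
proof -
  have N: "real N > 0" using assms(1) by simp
  have le: "pi * real \<gamma> / real N \<le> pi" if "\<gamma> \<le> N" for \<gamma>
    using that N by (simp add: divide_simps)
  have ge: "0 \<le> pi * real \<gamma> / real N" for \<gamma>
    by simp
  have "cos (pi * real \<alpha> / real N) = cos (pi * real \<beta> / real N)"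
    using assms(4) by (simp add: cheb_node_def)
  from cos_inj_pi[OF ge le[OF assms(2)] ge le[OF assms(3)] this]
  have "pi * real \<alpha> = pi * real \<beta>" using N by (simp only: divide_cancel_right) linarith
  thus ?thesis by simp
qed

lemma poly_cheb_basis_node:
  assumes "N \<ge> 1" "\<alpha> \<le> N" "\<beta> \<le> N"
  shows "poly (cheb_basis N \<alpha>) (cheb_node N \<beta>) = (if \<alpha> = \<beta> then 1 else 0)"
proof (cases "\<alpha> = \<beta>")
  case True
  have "poly (cheb_basis N \<alpha>) (cheb_node N \<alpha>) = (\<Prod>\<gamma>\<in>{0..N} - {\<alpha>}. 1)"
    unfolding cheb_basis_def poly_prod
  proof (rule prod.cong)
    fix \<gamma> assume "\<gamma> \<in> {0..N} - {\<alpha>}"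
    hence "cheb_node N \<alpha> - cheb_node N \<gamma> \<noteq> 0"
      using cheb_node_inj[OF assms(1,2), of \<gamma>] by fastforce
    thus "poly (Polynomial.smult (1 / (cheb_node N \<alpha> - cheb_node N \<gamma>)) [:- cheb_node N \<gamma>, 1:])
      (cheb_node N \<alpha>) = 1"
      by (simp add: diff_divide_distrib[symmetric])
  qed simp
  thus ?thesis using True by simp
next
  case False
  have "poly (cheb_basis N \<alpha>) (cheb_node N \<beta>) = 0"
    unfolding cheb_basis_def poly_prod
  proof (rule prod_zero)
    show "\<exists>\<gamma>\<in>{0..N} - {\<alpha>}. poly (Polynomial.smult (1 / (cheb_node N \<alpha> - cheb_node N \<gamma>))
        [:- cheb_node N \<gamma>, 1:]) (cheb_node N \<beta>) = 0"
      using False assms(3) by (intro bexI[of _ \<beta>]) auto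
  qed simp
  thus ?thesis using False by simp
qed

lemma degree_cheb_basis:
  assumes "N \<ge> 1" "\<alpha> \<le> N"
  shows "Polynomial.degree (cheb_basis N \<alpha>) = N"
proof -
  have nz: "cheb_node N \<alpha> - cheb_node N \<gamma> \<noteq> 0" if "\<gamma> \<in> {0..N} - {\<alpha>}" for \<gamma>
    using that cheb_node_inj[OF assms, of \<gamma>] by auto
  have "Polynomial.degree (cheb_basis N \<alpha>) = (\<Sum>\<gamma>\<in>{0..N} - {\<alpha>}.
      Polynomial.degree (Polynomial.smult (1 / (cheb_node N \<alpha> - cheb_node N \<gamma>)) [:- cheb_node N \<gamma>, 1:]))"
    unfolding cheb_basis_def using nz by (intro degree_prod_eq_sum_degree) simp
  also have "\<dots> = (\<Sum>\<gamma>\<in>{0..N} - {\<alpha>}. 1)"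
    using nz by (intro sum.cong) auto
  also have "\<dots> = N" using assms by simp
  finally show ?thesis .
qed

definition lebesgue_const :: "nat \<Rightarrow> real" where
  "lebesgue_const N = (SUP x\<in>{0..1}. \<Sum>\<alpha>=0..N. \<bar>poly (cheb_basis N \<alpha>) x\<bar>)"

text \<open>The real supremum above is over a bounded set, hence carries its usual meaning.\<close>

lemma bdd_above_lebesgue_sum:
  "bdd_above ((\<lambda>x. \<Sum>\<alpha>=0..N. \<bar>poly (cheb_basis N \<alpha>) x\<bar>) ` {0..1})"
proof -
  have "continuous_on {0..1::real} (\<lambda>x. \<Sum>\<alpha>=0..N. \<bar>poly (cheb_basis N \<alpha>) x\<bar>)"
    by (intro continuous_on_sum continuous_on_rabs continuous_on_poly continuous_on_id)
  from compact_continuous_image[OF this compact_Icc] show ?thesis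
    by (rule bounded_imp_bdd_above[OF compact_imp_bounded])
qed

text \<open>A function on the interval $[0,1]$ is modelled by a total function; every definition below
  evaluates it only at points of $[0,1]$. The interpolation error is extended-real, since an
  arbitrary such function may be unbounded.\<close>

definition interp_error :: "nat \<Rightarrow> nat \<Rightarrow> (real \<Rightarrow> real) \<Rightarrow> ereal" where
  "interp_error m N f = (SUP (u, v)\<in>{0..1 - 1 / 2 ^ m} \<times> {0..1}.
     ereal \<bar>f (u + v / 2 ^ m)
       - (\<Sum>\<alpha>=0..N. f (u + cheb_node N \<alpha> / 2 ^ m) * poly (cheb_basis N \<alpha>) v)\<bar>)"

text \<open>A tensor is a function of the multi-index $\sigma$, itself a function
  $\{1,\dots,K\} \to \{0,1\}$.\<close>

definition qtt :: "nat \<Rightarrow> (real \<Rightarrow> real) \<Rightarrow> (nat \<Rightarrow> nat) \<Rightarrow> real" where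
  "qtt K f \<sigma> = f (\<Sum>k=1..K. real (\<sigma> k) / 2 ^ k)"

definition tensor_norm :: "nat \<Rightarrow> ((nat \<Rightarrow> nat) \<Rightarrow> real) \<Rightarrow> real" where
  "tensor_norm K S = sqrt (1 / 2 ^ K * (\<Sum>\<sigma>\<in>{1..K} \<rightarrow>\<^sub>E {0, 1}. \<bar>S \<sigma>\<bar>\<^sup>2))"

text \<open>Matrix indices start at 0. The left core is the $2 \times (N+1)$ matrix with row index
  $\sigma$.\<close>

definition core_left :: "nat \<Rightarrow> (real \<Rightarrow> real) \<Rightarrow> real mat" where
  "core_left N f = mat 2 (N + 1) (\<lambda>(\<sigma>, \<beta>). f ((real \<sigma> + cheb_node N \<beta>) / 2))"

definition core_mid :: "nat \<Rightarrow> nat \<Rightarrow> real mat" where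
  "core_mid N \<sigma> = mat (N + 1) (N + 1)
     (\<lambda>(\<alpha>, \<beta>). poly (cheb_basis N \<alpha>) ((real \<sigma> + cheb_node N \<beta>) / 2))"

definition core_right :: "nat \<Rightarrow> nat \<Rightarrow> real mat" where
  "core_right N \<sigma> = mat (N + 1) 1 (\<lambda>(\<alpha>, _). poly (cheb_basis N \<alpha>) (real \<sigma> / 2))"

definition frob_norm :: "real mat \<Rightarrow> real" where
  "frob_norm M = sqrt (\<Sum>i<dim_row M. \<Sum>j<dim_col M. (M $$ (i, j))\<^sup>2)"

definition orthonormal_cols :: "real mat \<Rightarrow> bool" where
  "orthonormal_cols U \<longleftrightarrow> transpose_mat U * U = 1\<^sub>m (dim_col U)"

text \<open>Thin singular value decomposition $B = U D V^\top$, with the singular values on the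
  diagonal of $D$ in nonincreasing order.\<close>

definition is_svd :: "real mat \<Rightarrow> real mat \<Rightarrow> real mat \<Rightarrow> real mat \<Rightarrow> bool" where
  "is_svd B U D V \<longleftrightarrow>
     (let m = dim_row B; n = dim_col B; q = min m n in
        U \<in> carrier_mat m q \<and> D \<in> carrier_mat q q \<and> V \<in> carrier_mat n q \<and>
        orthonormal_cols U \<and> orthonormal_cols V \<and>
        diagonal_mat D \<and> (\<forall>i<q. 0 \<le> D $$ (i, i)) \<and>
        (\<forall>i j. i \<le> j \<longrightarrow> j < q \<longrightarrow> D $$ (j, j) \<le> D $$ (i, i)) \<and>
        B = U * D * transpose_mat V)"

definition is_truncated_svd ::
  "real mat \<Rightarrow> nat \<Rightarrow> real mat \<Rightarrow> real mat \<Rightarrow> real mat \<Rightarrow> bool" where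
  "is_truncated_svd B r U D V \<longleftrightarrow>
     r \<le> min (dim_row B) (dim_col B) \<and>
     (\<exists>U' D' V'. is_svd B U' D' V' \<and>
        U = mat (dim_row B) r (\<lambda>(i, j). U' $$ (i, j)) \<and>
        D = mat r r (\<lambda>(i, j). D' $$ (i, j)) \<and>
        V = mat (dim_col B) r (\<lambda>(i, j). V' $$ (i, j)))"

definition is_minimal_truncated_svd ::
  "real mat \<Rightarrow> real \<Rightarrow> nat \<Rightarrow> real mat \<Rightarrow> real mat \<Rightarrow> real mat \<Rightarrow> bool" where
  "is_minimal_truncated_svd B tol r U D V \<longleftrightarrow>
     is_truncated_svd B r U D V \<and>
     frob_norm (B - U * D * transpose_mat V) \<le> tol \<and>
     (\<forall>r'<r. \<forall>U' D' V'. is_truncated_svd B r' U' D' V' \<longrightarrow>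
        tol < frob_norm (B - U' * D' * transpose_mat V'))"

text \<open>The $2r \times n$ unfolding of a tensor has row index $(\sigma,\alpha)$, flattened to
  $\sigma r + \alpha$; this is the order in which \<^const>\<open>append_rows\<close> stacks the two slices, and
  the one used to read an unfolded matrix back as a core.\<close>

definition step_mat :: "nat \<Rightarrow> real mat \<Rightarrow> real mat" where
  "step_mat N R = append_rows (R * core_mid N 0) (R * core_mid N 1)"

definition core_slice :: "nat \<Rightarrow> real mat \<Rightarrow> nat \<Rightarrow> real mat" where
  "core_slice r U \<sigma> = mat r (dim_col U) (\<lambda>(i, j). U $$ (\<sigma> * r + i, j))"

definition rank_revealing ::
  "real \<Rightarrow> nat \<Rightarrow> nat \<Rightarrow> (real \<Rightarrow> real) \<Rightarrow> (nat \<Rightarrow> nat) \<Rightarrow> (nat \<Rightarrow> real mat) \<Rightarrow> (nat \<Rightarrow> real mat) \<Rightarrow> bool"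
where
  "rank_revealing \<epsilon> N K f r U R \<longleftrightarrow>
     r 0 = 1 \<and>
     U 1 \<in> carrier_mat 2 (r 1) \<and> R 1 \<in> carrier_mat (r 1) (N + 1) \<and>
     orthonormal_cols (U 1) \<and> core_left N f = U 1 * R 1 \<and>
     (\<forall>p\<in>{1..K - 2}. \<exists>D V.
        is_minimal_truncated_svd (step_mat N (R p)) (\<epsilon> * sqrt (2 ^ (p + 1)))
          (r (p + 1)) (U (p + 1)) D V \<and>
        R (p + 1) = D * transpose_mat V)"

primrec core_prod ::
  "(nat \<Rightarrow> nat) \<Rightarrow> (nat \<Rightarrow> real mat) \<Rightarrow> (nat \<Rightarrow> nat) \<Rightarrow> nat \<Rightarrow> real mat" where
  "core_prod r U \<sigma> 0 = 1\<^sub>m 1"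
| "core_prod r U \<sigma> (Suc k) = core_prod r U \<sigma> k * core_slice (r k) (U (Suc k)) (\<sigma> (Suc k))"

definition mps_output ::
  "nat \<Rightarrow> nat \<Rightarrow> (nat \<Rightarrow> nat) \<Rightarrow> (nat \<Rightarrow> real mat) \<Rightarrow> (nat \<Rightarrow> real mat) \<Rightarrow> (nat \<Rightarrow> nat) \<Rightarrow> real" where
  "mps_output N K r U R \<sigma> =
     (core_prod r U \<sigma> (K - 1) * R (K - 1) * core_right N (\<sigma> K)) $$ (0, 0)"

end

theory Submission
  imports Defs
begin

text \<open>
  The error bound is a telescoping argument. Let $S_p$ be the tensor
  $U_1 \cdots U_p R_p A \cdots A A_R$ in which the first $p$ cores come from the construction and the
  others are exact (\<open>hybrid\<close>). Interpolation of polynomials of degree at most $N$ is exact, so the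
  product of the exact cores is the vector of values $P^\alpha(y)$ at the point $y$ given by the
  remaining binary digits (\<open>poly_cheb_basis_refine\<close>). Hence $S_1$ is the interpolant of $f$
  on the halves of $[0,1]$ and differs from $T$ by at most $E_{1,N}[f]$ in every entry, while $S_{K-1}$
  is the output. The difference $S_p - S_{p+1}$ is the truncation error of one step, multiplied on the
  left by $U_1 \cdots U_p$, which is an isometry (\<open>core_prod_isometry\<close>), and on the right by the vector
  $(P^\alpha(y))_\alpha$, whose Euclidean norm is at most $\sum_\alpha |P^\alpha(y)| \le \Lambda_N$. The
  tolerance $\varepsilon\sqrt{2^{p+1}}$ is exactly compensated by the normalization of the tensor norm,
  so each of the $K-2$ truncations costs at most $\Lambda_N\varepsilon$ (\<open>tensor_norm_hybrid_step\<close>).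

  For the bound on $\Lambda_N$, substitute $x = (\cos\theta+1)/2$. Each basis polynomial is then a sum
  of two translates of the kernel $D_N(\phi) = \frac{1}{2}\sin(N\phi)\cot(\phi/2)$
  (\<open>poly_cheb_basis_cos\<close>), and the Lebesgue function is at most
  $\frac{1}{N}\sum_{i<2N} |D_N(\theta + i\pi/N)|$. This is periodic with period $\pi/N$, so only
  $\theta = \pi\delta/N$ with $0<\delta<1$ matters. The inequality $\cot x \le 1/x - x/3$ bounds it by
  \[\sin(\pi\delta) \Bigl(\frac{1}{\pi} \sum_{j<N} \Bigl(\frac{1}{j+\delta} +
    \frac{1}{j+1-\delta}\Bigr) - \frac{\pi}{12}\Bigr),\]
  and $\sin\pi\delta \le 4\delta(1-\delta)$ reduces this to its value at $\delta = \frac{1}{2}$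
  (for $N = 1$, to the bound $4/\pi$), where it is a harmonic sum over odd numbers that is compared
  with the logarithm (\<open>shifted_sum_le\<close>).
\<close>

section \<open>The Lagrange basis at the Chebyshev-Lobatto nodes\<close>

lemma poly_cos_multiple:
  "\<exists>p :: real poly. Polynomial.degree p \<le> k \<and> (\<forall>\<theta>. poly p (cos \<theta>) = cos (real k * \<theta>))"
proof (induction k rule: induct_nat_012)
  case 0
  show ?case by (rule exI[of _ "1"]) simp
next
  case 1
  show ?case by (rule exI[of _ "[:0, 1:]"]) simp
next
  case (ge2 k)
  then obtain p q :: "real poly" where
    p: "Polynomial.degree p \<le> k" "\<And>\<theta>. poly p (cos \<theta>) = cos (real k * \<theta>)" and
    q: "Polynomial.degree q \<le> Suc k" "\<And>\<theta>. poly q (cos \<theta>) = cos (real (Suc k) * \<theta>)"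
    by auto
  let ?r = "[:0, 2:] * q - p"
  have "Polynomial.degree ([:0, 2:] * q) \<le> Suc (Suc k)"
    using degree_mult_le[of "[:0, 2::real:]" q] q(1) by simp
  hence "Polynomial.degree ?r \<le> Suc (Suc k)"
    using p(1) by (intro degree_diff_le) auto
  moreover have "poly ?r (cos \<theta>) = cos (real (Suc (Suc k)) * \<theta>)" for \<theta>
  proof -
    have "2 * (cos \<theta> * cos (real (Suc k) * \<theta>)) =
        cos (real k * \<theta>) + cos (real (Suc (Suc k)) * \<theta>)"
      using cos_times_cos[of \<theta> "real (Suc k) * \<theta>"] cos_minus[of "real k * \<theta>"]
      by (simp add: algebra_simps)
    thus ?thesis by (simp add: p q)
  qed
  ultimately show ?case by blast
qed

text \<open>For $N \ge 1$, the modified Dirichlet kernel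
  $D_N(\phi) = \frac{1}{2} + \sum_{k=1}^{N-1} \cos k\phi + \frac{1}{2} \cos N\phi$. It is written
  as a sum of averages of neighbouring cosines, so that each summand, multiplied by
  $2 \sin(\phi/2)$, is a difference of consecutive values of $\cos(\phi/2) \sin(k\phi)$.\<close>

definition dirichlet :: "nat \<Rightarrow> real \<Rightarrow> real" where
  "dirichlet N \<phi> = (\<Sum>k<N. (cos (real k * \<phi>) + cos (real (Suc k) * \<phi>)) / 2)"

text \<open>For $\phi \notin 2\pi\mathbb{Z}$ this says
  $D_N(\phi) = \frac{1}{2} \sin(N\phi) \cot(\phi/2)$.\<close>

lemma dirichlet_closed: "2 * sin (\<phi> / 2) * dirichlet N \<phi> = cos (\<phi> / 2) * sin (real N * \<phi>)"
proof (induction N)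
  case 0
  show ?case by (simp add: dirichlet_def)
next
  case (Suc N)
  let ?m = "(real N + 1 / 2) * \<phi>"
  have a: "real N * \<phi> = ?m - \<phi> / 2" "real (Suc N) * \<phi> = ?m + \<phi> / 2"
    by (simp_all add: algebra_simps)
  have "2 * sin (\<phi> / 2) * dirichlet (Suc N) \<phi> =
      cos (\<phi> / 2) * sin (real N * \<phi>) +
      sin (\<phi> / 2) * (cos (real N * \<phi>) + cos (real (Suc N) * \<phi>))"
    using Suc by (simp add: dirichlet_def algebra_simps)
  also have "\<dots> = cos (\<phi> / 2) * sin (real (Suc N) * \<phi>)"
    unfolding a sin_add sin_diff cos_add cos_diff by (simp add: algebra_simps)
  finally show ?case .
qed

lemma dirichlet_minus: "dirichlet N (- \<phi>) = dirichlet N \<phi>"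
  by (simp add: dirichlet_def)

lemma cos_add_2pi_mult: "cos (x + 2 * pi * real k) = cos x"
  using cos.plus_of_nat[of x k] by (simp add: mult_ac)

lemma dirichlet_periodic: "dirichlet N (\<phi> + 2 * pi) = dirichlet N \<phi>"
proof -
  have "cos (real k * (\<phi> + 2 * pi)) = cos (real k * \<phi>)" for k
    using cos_add_2pi_mult[of "real k * \<phi>" k] by (simp add: algebra_simps)
  thus ?thesis by (simp only: dirichlet_def)
qed

lemma dirichlet_0 [simp]: "dirichlet N 0 = real N"
  by (simp add: dirichlet_def)

lemma dirichlet_node:
  assumes "0 < k" "k < 2 * N"
  shows "dirichlet N (pi * real k / real N) = 0"
proof -
  let ?\<phi> = "pi * real k / real N"
  have "sin (real N * ?\<phi>) = 0"
    using assms by (simp add: mult.commute)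
  moreover have "sin (?\<phi> / 2) > 0"
  proof (rule sin_gt_zero)
    have "real k < 2 * real N" using assms(2) by linarith
    thus "?\<phi> / 2 < pi" using assms by (simp add: field_simps)
  qed (use assms in simp)
  ultimately show ?thesis using dirichlet_closed[of ?\<phi> N] by simp
qed

lemma dirichlet_add_prod:
  "dirichlet N (\<theta> - \<psi>) + dirichlet N (\<theta> + \<psi>) =
   (\<Sum>k<N. cos (real k * \<psi>) * cos (real k * \<theta>) + cos (real (Suc k) * \<psi>) * cos (real (Suc k) * \<theta>))"
proof -
  have "cos (real k * (\<theta> - \<psi>)) + cos (real k * (\<theta> + \<psi>)) = 2 * (cos (real k * \<psi>) * cos (real k * \<theta>))" for k
    by (simp add: ring_distribs(1) right_diff_distrib cos_add cos_diff)
  note * = this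
  have avg: "(a + c) / 2 + (b + d) / 2 = x + y" if "a + b = 2 * x" "c + d = 2 * y"
    for a b c d x y :: real
  proof -
    have "x = (a + b) / 2" "y = (c + d) / 2" using that by auto
    thus ?thesis by (simp add: add_divide_distrib)
  qed
  have "(cos (real k * (\<theta> - \<psi>)) + cos (real (Suc k) * (\<theta> - \<psi>))) / 2 +
    (cos (real k * (\<theta> + \<psi>)) + cos (real (Suc k) * (\<theta> + \<psi>))) / 2
    = cos (real k * \<psi>) * cos (real k * \<theta>) + cos (real (Suc k) * \<psi>) * cos (real (Suc k) * \<theta>)" for k
    using avg[OF *[of k] *[of "Suc k"]] .
  thus ?thesis unfolding dirichlet_def sum.distrib[symmetric] by simp
qed

lemma poly_eq_of_cheb_nodes:
  assumes "N \<ge> 1" "Polynomial.degree p \<le> N" "Polynomial.degree q \<le> N"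
    and "\<And>\<beta>. \<beta> \<le> N \<Longrightarrow> poly p (cheb_node N \<beta>) = poly q (cheb_node N \<beta>)"
  shows "p = q"
proof (rule poly_eqI_degree[of "cheb_node N ` {0..N}"])
  have "inj_on (cheb_node N) {0..N}"
    using cheb_node_inj[OF assms(1)] by (auto intro: inj_onI)
  hence "card (cheb_node N ` {0..N}) = N + 1" by (simp add: card_image)
  thus "Polynomial.degree p < card (cheb_node N ` {0..N})"
    and "Polynomial.degree q < card (cheb_node N ` {0..N})"
    using assms(2,3) by auto
qed (use assms(4) in auto)

text \<open>The weights of the trapezoidal rule on the nodes: the two endpoints of the interval count half.\<close>

definition endpoint_weight :: "nat \<Rightarrow> nat \<Rightarrow> real" where
  "endpoint_weight N \<alpha> = (if \<alpha> = 0 \<or> \<alpha> = N then 1 / 2 else 1)"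

text \<open>Under $x = (\cos\theta + 1)/2$ the basis polynomials become sums of two translates of the
  kernel. The right-hand side is a polynomial of degree at most $N$ in $x$, because it is a
  combination of products $\cos(k\psi)\cos(k\theta)$ with $k \le N$. The kernel vanishes at all
  multiples of $\pi/N$ except those of $2\pi$, so both sides agree at the $N+1$ nodes.\<close>

lemma poly_cheb_basis_cos:
  assumes N: "N \<ge> 1" and \<alpha>: "\<alpha> \<le> N"
  defines "\<psi> \<equiv> pi * real \<alpha> / real N"
  shows "poly (cheb_basis N \<alpha>) ((cos \<theta> + 1) / 2) =
    endpoint_weight N \<alpha> / real N * (dirichlet N (\<theta> - \<psi>) + dirichlet N (\<theta> + \<psi>))"
proof -
  obtain t :: "nat \<Rightarrow> real poly" where
    t: "\<And>k. Polynomial.degree (t k) \<le> k" "\<And>k \<theta>. poly (t k) (cos \<theta>) = cos (real k * \<theta>)"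
    using poly_cos_multiple by metis
  define c where "c = endpoint_weight N \<alpha> / real N"
  define s where "s = Polynomial.smult c (\<Sum>k<N. Polynomial.smult (cos (real k * \<psi>)) (t k)
      + Polynomial.smult (cos (real (Suc k) * \<psi>)) (t (Suc k)))"
  define q where "q = pcompose s [:-1, 2:]"
  have "Polynomial.degree s \<le> N"
    unfolding s_def
    by (intro order.trans[OF degree_smult_le] degree_sum_le degree_add_le)
       (auto intro!: order.trans[OF degree_smult_le] order.trans[OF t(1)])
  hence degq: "Polynomial.degree q \<le> N"
    unfolding q_def by (simp add: degree_pcompose)
  have q: "poly q ((cos \<theta> + 1) / 2) = c * (dirichlet N (\<theta> - \<psi>) + dirichlet N (\<theta> + \<psi>))" for \<theta>
  proof -
    have "poly q ((cos \<theta> + 1) / 2) = poly s (cos \<theta>)"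
      by (simp add: q_def poly_pcompose add_divide_distrib)
    thus ?thesis
      unfolding dirichlet_add_prod by (simp add: s_def poly_sum t)
  qed
  have "cheb_basis N \<alpha> = q"
  proof (rule poly_eq_of_cheb_nodes[OF N _ degq])
    show "Polynomial.degree (cheb_basis N \<alpha>) \<le> N"
      using degree_cheb_basis[OF N \<alpha>] by simp
    fix \<beta> assume \<beta>: "\<beta> \<le> N"
    let ?\<theta> = "pi * real \<beta> / real N"
    have diff: "dirichlet N (?\<theta> - \<psi>) = (if \<alpha> = \<beta> then real N else 0)"
    proof -
      consider "\<alpha> = \<beta>" | "\<alpha> < \<beta>" | "\<beta> < \<alpha>" by linarith
      thus ?thesis
      proof cases
        case 2
        hence "?\<theta> - \<psi> = pi * real (\<beta> - \<alpha>) / real N"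
          by (simp add: \<psi>_def of_nat_diff algebra_simps diff_divide_distrib)
        thus ?thesis using dirichlet_node[of "\<beta> - \<alpha>" N] 2 \<beta> by simp
      next
        case 3
        hence "- (?\<theta> - \<psi>) = pi * real (\<alpha> - \<beta>) / real N"
          by (simp add: \<psi>_def of_nat_diff algebra_simps diff_divide_distrib)
        thus ?thesis using dirichlet_node[of "\<alpha> - \<beta>" N] dirichlet_minus[of N "?\<theta> - \<psi>"] 3 \<alpha>
          by simp
      qed (simp add: \<psi>_def)
    qed
    have sum: "dirichlet N (?\<theta> + \<psi>) = (if \<alpha> = \<beta> \<and> (\<alpha> = 0 \<or> \<alpha> = N) then real N else 0)"
    proof -
      have e: "?\<theta> + \<psi> = pi * real (\<alpha> + \<beta>) / real N"
        by (simp add: \<psi>_def algebra_simps add_divide_distrib)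
      consider "\<alpha> + \<beta> = 0" | "\<alpha> + \<beta> = 2 * N" | "0 < \<alpha> + \<beta>" "\<alpha> + \<beta> < 2 * N"
        using \<alpha> \<beta> by linarith
      thus ?thesis
      proof cases
        case 2
        hence "\<alpha> = N" "\<beta> = N" using \<alpha> \<beta> by auto
        thus ?thesis using N dirichlet_periodic[of N 0] by (simp add: \<psi>_def)
      next
        case 3
        thus ?thesis using dirichlet_node[OF 3] e by auto
      qed (simp add: \<psi>_def)
    qed
    show "poly (cheb_basis N \<alpha>) (cheb_node N \<beta>) = poly q (cheb_node N \<beta>)"
      unfolding poly_cheb_basis_node[OF N \<alpha> \<beta>] using N
      by (simp add: q cheb_node_def diff sum c_def endpoint_weight_def)
  qed
  thus ?thesis using q c_def by simp
qed

section \<open>Elementary inequalities\<close>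

lemma mult_cos_le_sin:
  assumes "0 \<le> x" "x \<le> pi"
  shows "x * cos x \<le> sin x"
proof -
  have "sin 0 - 0 * cos 0 \<le> sin x - x * cos x"
  proof (rule DERIV_nonneg_imp_nondecreasing[OF assms(1)])
    fix y assume y: "0 \<le> y" "y \<le> x"
    have "((\<lambda>x. sin x - x * cos x) has_real_derivative y * sin y) (at y)"
      by (auto intro!: derivative_eq_intros)
    moreover have "y * sin y \<ge> 0"
      using y assms by (intro mult_nonneg_nonneg sin_ge_zero) auto
    ultimately show "\<exists>D. ((\<lambda>x. sin x - x * cos x) has_real_derivative D) (at y) \<and> D \<ge> 0"
      by blast
  qed
  thus ?thesis by simp
qed

text \<open>On $(0,\pi)$ this says $\cot x \le 1/x - x/3$. The term $-x/3$ is needed: with $\cot x \le 1/x$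
  alone, the final estimate of the Lebesgue constant would exceed $1 + \frac{2}{\pi}\log(N+1)$ for
  large $N$.\<close>

lemma mult_cos_le_sin_mult:
  assumes "0 \<le> x" "x \<le> pi"
  shows "x * cos x \<le> sin x * (1 - x\<^sup>2 / 3)"
proof -
  have "sin 0 * (1 - 0\<^sup>2 / 3) - 0 * cos 0 \<le> sin x * (1 - x\<^sup>2 / 3) - x * cos x"
  proof (rule DERIV_nonneg_imp_nondecreasing[OF assms(1)])
    fix y assume y: "0 \<le> y" "y \<le> x"
    have "((\<lambda>x. sin x * (1 - x\<^sup>2 / 3) - x * cos x) has_real_derivative
        y / 3 * (sin y - y * cos y)) (at y)"
      by (auto intro!: derivative_eq_intros simp: algebra_simps power2_eq_square)
    moreover have "y / 3 * (sin y - y * cos y) \<ge> 0"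
      using y assms mult_cos_le_sin[of y] by (intro mult_nonneg_nonneg) auto
    ultimately show "\<exists>D. ((\<lambda>x. sin x * (1 - x\<^sup>2 / 3) - x * cos x) has_real_derivative D) (at y)
        \<and> D \<ge> 0" by blast
  qed
  thus ?thesis by simp
qed

lemma abs_dirichlet_le:
  assumes "0 < \<phi>" "\<phi> \<le> pi"
  shows "\<bar>dirichlet N \<phi>\<bar> \<le> \<bar>sin (real N * \<phi>)\<bar> * (1 / \<phi> - \<phi> / 12)"
proof -
  have s: "sin (\<phi> / 2) > 0" using assms by (intro sin_gt_zero) auto
  have c: "cos (\<phi> / 2) \<ge> 0" using assms by (intro cos_ge_zero) auto
  have "\<phi> / 2 * cos (\<phi> / 2) \<le> sin (\<phi> / 2) * (1 - (\<phi> / 2)\<^sup>2 / 3)"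
    using assms by (intro mult_cos_le_sin_mult) auto
  hence "cos (\<phi> / 2) / (2 * sin (\<phi> / 2)) \<le> 1 / \<phi> - \<phi> / 12"
    using s assms by (simp add: field_simps power2_eq_square)
  moreover have "dirichlet N \<phi> = sin (real N * \<phi>) * (cos (\<phi> / 2) / (2 * sin (\<phi> / 2)))"
    using dirichlet_closed[of \<phi> N] s by (simp add: field_simps)
  hence "\<bar>dirichlet N \<phi>\<bar> = \<bar>sin (real N * \<phi>)\<bar> * (cos (\<phi> / 2) / (2 * sin (\<phi> / 2)))"
    using s c by (simp add: abs_mult)
  ultimately show ?thesis
    using mult_left_mono[OF _ abs_ge_zero[of "sin (real N * \<phi>)"]] by metis
qed

lemma sin_ge_chord:
  assumes "0 \<le> x" "x \<le> pi / 4"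
  shows "2 * sqrt 2 / pi * x \<le> sin x"
proof (cases "x = 0")
  case False
  hence x: "0 < x" using assms by simp
  have "sin (pi / 4) / (pi / 4) \<le> sin x / x"
  proof (rule DERIV_nonpos_imp_nonincreasing[OF assms(2)])
    fix y assume y: "x \<le> y" "y \<le> pi / 4"
    hence y0: "0 < y" using x by simp
    have "((\<lambda>x. sin x / x) has_real_derivative (y * cos y - sin y) / y\<^sup>2) (at y)"
      using y0 by (auto intro!: derivative_eq_intros simp: power2_eq_square mult.commute)
    moreover have "(y * cos y - sin y) / y\<^sup>2 \<le> 0"
      using y y0 mult_cos_le_sin[of y] by (intro divide_nonpos_nonneg) auto
    ultimately show "\<exists>D. ((\<lambda>x. sin x / x) has_real_derivative D) (at y) \<and> D \<le> 0" by blast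
  qed
  thus ?thesis using x by (simp add: sin_45 field_simps)
qed simp

lemma sin_pi_le_parabola:
  assumes "0 \<le> \<delta>" "\<delta> \<le> 1"
  shows "sin (pi * \<delta>) \<le> 4 * (\<delta> * (1 - \<delta>))"
proof -
  define y where "y = \<bar>1 / 2 - \<delta>\<bar>"
  have y: "0 \<le> y" "y \<le> 1 / 2" using assms unfolding y_def by linarith+
  have "2 * sqrt 2 / pi * (pi / 2 * y) \<le> sin (pi / 2 * y)"
    using y by (intro sin_ge_chord) auto
  hence "(sqrt 2 * y)\<^sup>2 \<le> (sin (pi / 2 * y))\<^sup>2"
    using y by (intro power_mono) auto
  hence "2 * y\<^sup>2 \<le> (sin (pi / 2 * y))\<^sup>2"
    by (simp add: power_mult_distrib)
  moreover have "cos (2 * (pi / 2 * y)) = 1 - 2 * (sin (pi / 2 * y))\<^sup>2"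
    by (rule cos_double_sin)
  ultimately have "cos (pi * y) \<le> 1 - 4 * y\<^sup>2" by simp
  moreover have "sin (pi * \<delta>) = cos (pi * (1 / 2 - \<delta>))"
    using sin_cos_eq[of "pi * \<delta>"] by (simp add: algebra_simps)
  moreover have "cos (pi * (1 / 2 - \<delta>)) = cos (pi * y)"
    using cos_abs_real[of "pi * (1 / 2 - \<delta>)"] by (simp add: y_def abs_mult)
  moreover have "y\<^sup>2 = (1 / 2 - \<delta>)\<^sup>2" by (simp add: y_def)
  ultimately show ?thesis by (simp add: power2_eq_square algebra_simps)
qed

text \<open>The midpoint rule underestimates $\int_{N}^{N+1} dx/x$, by convexity; summing from $N = 2$
  rather than $N = 1$ keeps the constant small enough for later use.\<close>

lemma sum_odd_harmonic_le:
  assumes "N \<ge> 2"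
  shows "(\<Sum>j<N. 4 / (2 * real j + 1)) \<le> 16 / 3 - 2 * ln 2 + 2 * ln (real N)"
  using assms
proof (induction N rule: nat_induct_at_least)
  case base
  show ?case by (simp add: eval_nat_numeral)
next
  case (Suc N)
  have "2 * (real (Suc N) - real N) / (real N + real (Suc N)) \<le> ln (real (Suc N)) - ln (real N)"
    using Suc.hyps by (intro ln_inverse_approx_ge) auto
  hence "4 / (2 * real N + 1) \<le> 2 * ln (real (Suc N)) - 2 * ln (real N)"
    by (simp add: field_simps)
  thus ?case using Suc.IH by simp
qed

lemma ln2_ge_56_81: "56 / 81 \<le> ln (2 :: real)"
  using ln_approx_bounds[of 2 2] by (simp add: eval_nat_numeral)

text \<open>The left-hand side bounds the Lebesgue function at the angle $\pi\delta/N$. Put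
  $s = \delta(1-\delta) \in (0, \frac{1}{4}]$. Pairing the two fractions gives
  $(2j+1)/(j(j+1)+s)$, and $\sin \pi\delta \le 4s$ leaves an expression that is largest at
  $s = \frac{1}{4}$, the midpoint between two nodes, if $N \ge 2$, and at most $4/\pi$ if $N = 1$.\<close>

lemma shifted_sum_le:
  assumes N: "N \<ge> 1" and \<delta>: "0 < \<delta>" "\<delta> < 1"
  shows "sin (pi * \<delta>) * ((\<Sum>j<N. 1 / (real j + \<delta>) + 1 / (real j + 1 - \<delta>)) / pi - pi / 12)
    \<le> 1 + 2 / pi * ln (real N + 1)"
proof -
  define s where "s = \<delta> * (1 - \<delta>)"
  define S where "S = (\<Sum>j<N. (2 * real j + 1) / (real j * (real j + 1) + s))"
  have s: "0 < s" "s \<le> 1 / 4"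
  proof -
    have "0 \<le> (\<delta> - 1 / 2)\<^sup>2" by simp
    thus "s \<le> 1 / 4" by (simp add: s_def power2_eq_square algebra_simps)
  qed (use \<delta> in \<open>simp add: s_def\<close>)
  have pi: "157 / 50 \<le> pi" "pi \<le> 63 / 20" using pi_approx by auto
  have pi2: "(157 / 50) * (157 / 50) \<le> pi * pi" "pi * pi \<le> (63 / 20) * (63 / 20)"
    using pi by (intro mult_mono; simp)+
  have den: "real j * (real j + 1) + s > 0" for j
    using s by (intro add_nonneg_pos) auto
  have "1 / (real j + \<delta>) + 1 / (real j + 1 - \<delta>) = (2 * real j + 1) / (real j * (real j + 1) + s)"
    for j
  proof -
    have "real j + \<delta> > 0" "real j + 1 - \<delta> > 0" using \<delta> by auto
    moreover have "(real j + \<delta>) * (real j + 1 - \<delta>) = real j * (real j + 1) + s"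
      by (simp add: s_def algebra_simps)
    ultimately show ?thesis using den[of j] by (simp add: add_frac_eq)
  qed
  hence S: "(\<Sum>j<N. 1 / (real j + \<delta>) + 1 / (real j + 1 - \<delta>)) = S"
    by (simp add: S_def)
  have "(\<Sum>j\<in>{0}. (2 * real j + 1) / (real j * (real j + 1) + s)) \<le> S"
    unfolding S_def using N den by (intro sum_mono2) (auto simp: less_imp_le)
  hence "1 / s \<le> S" by simp
  moreover have "4 \<le> 1 / s" using s by (simp add: field_simps)
  ultimately have "4 \<le> S" by simp
  have "pi * pi \<le> 12 * S" using pi2 \<open>4 \<le> S\<close> by linarith
  hence "S / pi - pi / 12 \<ge> 0" using pi by (simp add: field_simps)
  hence "sin (pi * \<delta>) * (S / pi - pi / 12) \<le> 4 * s * (S / pi - pi / 12)"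
    using sin_pi_le_parabola[of \<delta>] \<delta> by (intro mult_right_mono) (auto simp: s_def)
  also have "\<dots> = (4 * s * S - s * (pi * pi) / 3) / pi"
    using pi by (simp add: field_simps)
  also have "\<dots> \<le> (pi + 2 * ln (real N + 1)) / pi"
  proof (intro divide_right_mono)
    show "4 * s * S - s * (pi * pi) / 3 \<le> pi + 2 * ln (real N + 1)"
    proof (cases "N = 1")
      case True
      have "4 * s * S = 4" using s True by (simp add: S_def)
      moreover have "s * (pi * pi) \<ge> 0" using s by simp
      ultimately show ?thesis using pi ln2_ge_56_81 True by simp
    next
      case False
      hence N2: "N \<ge> 2" using N by simp
      define g where "g = (\<lambda>j. 4 * s * ((2 * real j + 1) / (real j * (real j + 1) + s)))"
      have g_le: "g j \<le> 4 / (2 * real j + 1)" for j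
      proof -
        have "4 * s * ((2 * real j + 1) * (2 * real j + 1)) \<le> 4 * (real j * (real j + 1) + s)"
        proof -
          have "4 * s * (real j * (real j + 1)) \<le> 1 * (real j * (real j + 1))"
            using s by (intro mult_right_mono) auto
          thus ?thesis by (simp add: algebra_simps)
        qed
        thus ?thesis using den[of j] by (simp add: g_def field_simps)
      qed
      \<comment> \<open>Replacing $s$ by $1/4$ decreases no $g_j$, but increases the subtracted $s\pi^2/3$. The gain in $g_1$ alone pays for that.\<close>
      have g1: "g 1 - s * (pi * pi) / 3 \<le> 4 / 3 - pi * pi / 12"
      proof -
        have "pi * pi * (2 + s) \<le> ((63 / 20) * (63 / 20)) * (2 + 1 / 4)"
          using s by (intro mult_mono[OF pi2(2)]) auto
        also have "\<dots> \<le> 32" by simp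
        finally have "pi * pi / 3 \<le> 32 / 3 / (2 + s)" using s by (simp add: field_simps)
        hence "(1 / 4 - s) * (pi * pi / 3) \<le> (1 / 4 - s) * (32 / 3 / (2 + s))"
          using s by (intro mult_left_mono) auto
        moreover have "4 / 3 - g 1 = (1 / 4 - s) * (32 / 3 / (2 + s))"
          using s by (simp add: g_def field_simps)
        moreover have "(1 / 4 - s) * (pi * pi / 3) = pi * pi / 12 - s * (pi * pi) / 3"
          by (simp add: field_simps)
        ultimately show ?thesis by linarith
      qed
      have "4 * s * S - s * (pi * pi) / 3 = sum g {..<N} - s * (pi * pi) / 3"
        by (simp add: S_def g_def sum_distrib_left)
      also have "\<dots> = sum g ({..<N} - {1}) + (g 1 - s * (pi * pi) / 3)"
        using N2 by (subst sum.remove[of _ 1]) auto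
      also have "\<dots> \<le> (\<Sum>j\<in>{..<N} - {1}. 4 / (2 * real j + 1)) + (4 / 3 - pi * pi / 12)"
        using g1 g_le by (intro add_mono sum_mono)
      also have "\<dots> = (\<Sum>j<N. 4 / (2 * real j + 1)) - pi * pi / 12"
        using N2 by (subst sum.remove[of "{..<N}" 1]) auto
      also have "\<dots> \<le> 16 / 3 - 2 * ln 2 + 2 * ln (real N) - pi * pi / 12"
        using sum_odd_harmonic_le[OF N2] by simp
      also have "ln (real N) \<le> ln (real N + 1)" using N by simp
      finally show ?thesis using ln2_ge_56_81 pi pi_approx pi2 by linarith
    qed
  qed simp
  also have "\<dots> = 1 + 2 / pi * ln (real N + 1)" by (simp add: field_simps)
  finally show ?thesis by (simp add: S)
qed

lemma abs_sin_add_nat_pi: "\<bar>sin (x + pi * real j)\<bar> = \<bar>sin x\<bar>"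
  by (simp add: sin_add abs_mult mult.commute[of pi])

section \<open>The Lebesgue constant\<close>

text \<open>The $2N$ points $\pi(i+\delta)/N$ are folded by the reflection $\phi \mapsto 2\pi - \phi$ onto
  $\pi(j+\delta)/N$ and $\pi(j+1-\delta)/N$ with $j < N$. All of these lie in $(0,\pi]$, where the
  bound for the kernel applies, and at all of them $|\sin N\phi| = \sin \pi\delta$.\<close>

lemma sum_abs_dirichlet_base_le:
  assumes N: "N \<ge> 1" and \<delta>: "0 < \<delta>" "\<delta> < 1"
  shows "(\<Sum>i<2 * N. \<bar>dirichlet N (pi * (real i + \<delta>) / real N)\<bar>) / real N
    \<le> 1 + 2 / pi * ln (real N + 1)"
proof -
  define h where "h = (\<lambda>x. \<bar>dirichlet N (pi * x / real N)\<bar>)"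
  have N0: "real N > 0" using N by simp
  have h_le: "h x \<le> \<bar>sin (pi * x)\<bar> * (real N / (pi * x) - pi * x / (12 * real N))"
    if "0 < x" "x \<le> real N" for x
  proof -
    have "pi * x / real N \<le> pi" using that N0 by (simp add: field_simps)
    from abs_dirichlet_le[OF _ this, of N] show ?thesis
      using that N0 by (simp add: h_def mult.commute[of "real N" 12])
  qed
  have le1: "h (real j + \<delta>) \<le> sin (pi * \<delta>) *
      (real N / (pi * (real j + \<delta>)) - pi * (real j + \<delta>) / (12 * real N))" if "j < N" for j
  proof -
    have "\<bar>sin (pi * (real j + \<delta>))\<bar> = sin (pi * \<delta>)"
      using abs_sin_add_nat_pi[of "pi * \<delta>" j] sin_ge_zero[of "pi * \<delta>"] \<delta>
      by (simp add: algebra_simps)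
    moreover have "real j + 1 \<le> real N" using that by linarith
    hence "real j + \<delta> \<le> real N" using \<delta> by linarith
    ultimately show ?thesis using h_le[of "real j + \<delta>"] \<delta> by simp
  qed
  have le2: "h (real j + 1 - \<delta>) \<le> sin (pi * \<delta>) *
      (real N / (pi * (real j + 1 - \<delta>)) - pi * (real j + 1 - \<delta>) / (12 * real N))" if "j < N" for j
  proof -
    have "pi * (real j + 1 - \<delta>) = - (pi * \<delta>) + pi * real (Suc j)" by (simp add: algebra_simps)
    hence "\<bar>sin (pi * (real j + 1 - \<delta>))\<bar> = sin (pi * \<delta>)"
      using abs_sin_add_nat_pi[of "- (pi * \<delta>)" "Suc j"] sin_ge_zero[of "pi * \<delta>"] \<delta>
      by simp
    moreover have "real j + 1 \<le> real N" using that by linarith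
    hence "real j + 1 - \<delta> \<le> real N" using \<delta> by linarith
    ultimately show ?thesis using h_le[of "real j + 1 - \<delta>"] \<delta> by simp
  qed
  have reflect: "h (2 * real N - x) = h x" for x
  proof -
    have "pi * (2 * real N - x) / real N = - (pi * x / real N) + 2 * pi"
      using N0 by (simp add: field_simps)
    thus ?thesis by (simp only: h_def dirichlet_periodic dirichlet_minus)
  qed
  have "(\<Sum>i<2 * N. h (real i + \<delta>)) = (\<Sum>i<N. h (real i + \<delta>)) + (\<Sum>i=N..<2 * N. h (real i + \<delta>))"
    using sum.atLeastLessThan_concat[of 0 N "2 * N" "\<lambda>i. h (real i + \<delta>)"]
    by (simp add: lessThan_atLeast0)
  also have "(\<Sum>i=N..<2 * N. h (real i + \<delta>)) = (\<Sum>j<N. h (real j + 1 - \<delta>))"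
  proof (rule sum.reindex_bij_witness[of _ "\<lambda>j. 2 * N - 1 - j" "\<lambda>i. 2 * N - 1 - i"])
    fix i assume i: "i \<in> {N..<2 * N}"
    hence "real (2 * N - 1 - i) + 1 - \<delta> = 2 * real N - (real i + \<delta>)"
      by (auto simp: of_nat_diff)
    thus "h (real (2 * N - 1 - i) + 1 - \<delta>) = h (real i + \<delta>)" by (simp only: reflect)
  qed (use N in auto)
  also have "(\<Sum>i<N. h (real i + \<delta>)) + (\<Sum>j<N. h (real j + 1 - \<delta>)) \<le>
    (\<Sum>j<N. sin (pi * \<delta>) * (real N / (pi * (real j + \<delta>)) - pi * (real j + \<delta>) / (12 * real N))) +
    (\<Sum>j<N. sin (pi * \<delta>) * (real N / (pi * (real j + 1 - \<delta>)) - pi * (real j + 1 - \<delta>) / (12 * real N)))"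
    using le1 le2 by (intro add_mono sum_mono) auto
  also have "\<dots> = (\<Sum>j<N. sin (pi * \<delta>) * (real N / pi * (1 / (real j + \<delta>) + 1 / (real j + 1 - \<delta>))
      - pi / (12 * real N) * (2 * real j + 1)))"
    unfolding sum.distrib[symmetric]
    by (intro sum.cong refl) (simp add: algebra_simps add_divide_distrib diff_divide_distrib)
  also have "\<dots> = sin (pi * \<delta>) * (real N / pi * (\<Sum>j<N. 1 / (real j + \<delta>) + 1 / (real j + 1 - \<delta>))
      - pi / (12 * real N) * (\<Sum>j<N. 2 * real j + 1))"
    by (simp only: sum_distrib_left[symmetric] sum_subtractf)
  also have "(\<Sum>j<N. 2 * real j + 1) = real N * real N"
    by (induction N) (simp_all add: algebra_simps)
  also have "sin (pi * \<delta>) * (real N / pi * (\<Sum>j<N. 1 / (real j + \<delta>) + 1 / (real j + 1 - \<delta>))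
      - pi / (12 * real N) * (real N * real N)) =
     real N * (sin (pi * \<delta>) * ((\<Sum>j<N. 1 / (real j + \<delta>) + 1 / (real j + 1 - \<delta>)) / pi - pi / 12))"
    using N0 by (simp add: field_simps)
  also have "\<dots> \<le> real N * (1 + 2 / pi * ln (real N + 1))"
    using shifted_sum_le[OF N \<delta>] N0 by (intro mult_left_mono) auto
  finally show ?thesis using N0 unfolding h_def by (simp add: pos_divide_le_eq mult.commute)
qed

lemma sum_lessThan_shift_periodic:
  fixes g :: "nat \<Rightarrow> real"
  assumes "\<And>i. g (i + P) = g i"
  shows "(\<Sum>i<P. g (i + m)) = (\<Sum>i<P. g i)"
proof (induction m)
  case (Suc m)
  have "(\<Sum>i<P. g (Suc i + m)) + g m = (\<Sum>i<P. g (i + m)) + g (P + m)"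
    using sum.lessThan_Suc_shift[of "\<lambda>i. g (i + m)" P]
      sum.lessThan_Suc[of "\<lambda>i. g (i + m)" P] by simp
  moreover have "g (P + m) = g m" using assms[of m] by (simp add: add.commute)
  ultimately show ?case using Suc by simp
qed simp

lemma sum_endpoint_weight_fold:
  fixes h :: "nat \<Rightarrow> real"
  assumes N: "N \<ge> 1" and h: "h (2 * N) = h 0"
  shows "(\<Sum>\<alpha>=0..N. endpoint_weight N \<alpha> * (h (2 * N - \<alpha>) + h \<alpha>)) = (\<Sum>i<2 * N. h i)"
proof -
  have reflect: "(\<Sum>i\<in>{N<..<2 * N}. h i) = (\<Sum>\<alpha>\<in>{0<..<N}. h (2 * N - \<alpha>))"
    by (rule sum.reindex_bij_witness[of _ "\<lambda>j. 2 * N - j" "\<lambda>i. 2 * N - i"]) auto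
  have "{0..N} = insert 0 (insert N {0<..<N})" using N by auto
  hence "(\<Sum>\<alpha>=0..N. endpoint_weight N \<alpha> * (h (2 * N - \<alpha>) + h \<alpha>)) =
      h 0 + (h N + (\<Sum>\<alpha>\<in>{0<..<N}. endpoint_weight N \<alpha> * (h (2 * N - \<alpha>) + h \<alpha>)))"
    using N h by (simp add: endpoint_weight_def)
  also have "(\<Sum>\<alpha>\<in>{0<..<N}. endpoint_weight N \<alpha> * (h (2 * N - \<alpha>) + h \<alpha>)) =
      (\<Sum>i\<in>{N<..<2 * N}. h i) + (\<Sum>\<alpha>\<in>{0<..<N}. h \<alpha>)"
    unfolding reflect sum.distrib[symmetric] by (intro sum.cong) (auto simp: endpoint_weight_def)
  also have "h 0 + (h N + \<dots>) = sum h (insert 0 (insert N ({N<..<2 * N} \<union> {0<..<N})))"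
    using N by (subst sum.insert | subst sum.union_disjoint | force)+
  also have "insert 0 (insert N ({N<..<2 * N} \<union> {0<..<N})) = {..<2 * N}" using N by auto
  finally show ?thesis .
qed

text \<open>At a node the sum is $1$. At any other point, the triangle inequality applied to
  the two translates of the kernel gives a sum over the $2N$ translates by multiples of $\pi/N$, and
  this sum depends only on the position of $\theta$ between two consecutive multiples.\<close>

lemma lebesgue_sum_le:
  assumes N: "N \<ge> 1" and x: "x \<in> {0..1}"
  shows "(\<Sum>\<alpha>=0..N. \<bar>poly (cheb_basis N \<alpha>) x\<bar>) \<le> 1 + 2 / pi * ln (real N + 1)"
proof -
  define \<theta> where "\<theta> = arccos (2 * x - 1)"
  have \<theta>: "0 \<le> \<theta>" "\<theta> \<le> pi" "x = (cos \<theta> + 1) / 2"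
    using x arccos_lbound[of "2 * x - 1"] arccos_ubound[of "2 * x - 1"]
    by (auto simp: \<theta>_def)
  have N0: "real N > 0" using N by simp
  \<comment> \<open>$\theta = \pi(m+\delta)/N$ with $0 \le \delta < 1$\<close>
  define m where "m = nat \<lfloor>real N * \<theta> / pi\<rfloor>"
  define \<delta> where "\<delta> = real N * \<theta> / pi - real m"
  have "real m = of_int \<lfloor>real N * \<theta> / pi\<rfloor>" using \<theta> by (simp add: m_def)
  hence \<delta>: "0 \<le> \<delta>" "\<delta> < 1" unfolding \<delta>_def by linarith+
  have \<theta>m: "\<theta> = pi * (real m + \<delta>) / real N" using N0 by (simp add: \<delta>_def)
  show ?thesis
  proof (cases "\<delta> = 0")
    case True
    have "real m = real N * \<theta> / pi" using True by (simp add: \<delta>_def)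
    also have "\<dots> \<le> real N" using \<theta>(2) N0 by (simp add: pos_divide_le_eq mult.commute[of \<theta>] mult_left_mono)
    finally have "m \<le> N" by simp
    have "x = cheb_node N m" using True \<theta> \<theta>m by (simp add: cheb_node_def)
    hence "(\<Sum>\<alpha>=0..N. \<bar>poly (cheb_basis N \<alpha>) x\<bar>) = (\<Sum>\<alpha>=0..N. if m = \<alpha> then 1 else 0)"
      using poly_cheb_basis_node[OF N _ \<open>m \<le> N\<close>] by (intro sum.cong) auto
    also have "\<dots> = 1" using \<open>m \<le> N\<close> by simp
    finally show ?thesis by simp
  next
    case False
    define h where "h = (\<lambda>i. \<bar>dirichlet N (\<theta> + pi * real i / real N)\<bar>)"
    have per: "h (i + 2 * N) = h i" for i
    proof -
      have "\<theta> + pi * real (i + 2 * N) / real N = \<theta> + pi * real i / real N + 2 * pi"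
        using N0 by (simp add: field_simps)
      thus ?thesis by (simp only: h_def dirichlet_periodic)
    qed
    have reflect: "\<bar>dirichlet N (\<theta> - pi * real \<alpha> / real N)\<bar> = h (2 * N - \<alpha>)" if "\<alpha> \<le> N" for \<alpha>
    proof -
      have "\<theta> + pi * real (2 * N - \<alpha>) / real N = \<theta> - pi * real \<alpha> / real N + 2 * pi"
        using N0 that by (simp add: of_nat_diff field_simps)
      thus ?thesis by (simp only: h_def dirichlet_periodic)
    qed
    have "(\<Sum>\<alpha>=0..N. \<bar>poly (cheb_basis N \<alpha>) x\<bar>) \<le>
        (\<Sum>\<alpha>=0..N. endpoint_weight N \<alpha> * (h (2 * N - \<alpha>) + h \<alpha>) / real N)"
    proof (rule sum_mono)
      fix \<alpha> assume \<alpha>: "\<alpha> \<in> {0..N}"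
      let ?\<psi> = "pi * real \<alpha> / real N"
      have w: "endpoint_weight N \<alpha> / real N \<ge> 0" by (simp add: endpoint_weight_def)
      have "\<bar>poly (cheb_basis N \<alpha>) x\<bar> =
          endpoint_weight N \<alpha> / real N * \<bar>dirichlet N (\<theta> - ?\<psi>) + dirichlet N (\<theta> + ?\<psi>)\<bar>"
        using poly_cheb_basis_cos[OF N, of \<alpha> \<theta>] \<alpha>
        by (simp only: \<theta>(3) abs_mult abs_of_nonneg[OF w] atLeastAtMost_iff)
      also have "\<dots> \<le> endpoint_weight N \<alpha> / real N * (h (2 * N - \<alpha>) + h \<alpha>)"
        using w reflect[of \<alpha>] \<alpha> by (intro mult_left_mono) (auto simp: h_def)
      finally show "\<bar>poly (cheb_basis N \<alpha>) x\<bar> \<le> endpoint_weight N \<alpha> * (h (2 * N - \<alpha>) + h \<alpha>) / real N"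
        by simp
    qed
    also have "\<dots> = (\<Sum>i<2 * N. h i) / real N"
      using sum_endpoint_weight_fold[OF N, of h] per[of 0] by (simp add: sum_divide_distrib[symmetric])
    also have "(\<Sum>i<2 * N. h i) = (\<Sum>i<2 * N. \<bar>dirichlet N (pi * (real i + \<delta>) / real N)\<bar>)"
    proof -
      define g where "g = (\<lambda>i. \<bar>dirichlet N (pi * (real i + \<delta>) / real N)\<bar>)"
      have "g (i + 2 * N) = g i" for i
      proof -
        have "pi * (real (i + 2 * N) + \<delta>) / real N = pi * (real i + \<delta>) / real N + 2 * pi"
          using N0 by (simp add: field_simps)
        thus ?thesis by (simp only: g_def dirichlet_periodic)
      qed
      from sum_lessThan_shift_periodic[of g, OF this, of m]
      have "(\<Sum>i<2 * N. g (i + m)) = (\<Sum>i<2 * N. g i)" .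
      moreover have "h i = g (i + m)" for i
        using N0 by (simp add: h_def g_def \<theta>m add_divide_distrib algebra_simps)
      ultimately show ?thesis by (simp add: g_def)
    qed
    also have "\<dots> / real N \<le> 1 + 2 / pi * ln (real N + 1)"
      using sum_abs_dirichlet_base_le[OF N, of \<delta>] \<delta> False by simp
    finally show ?thesis .
  qed
qed

lemma lebesgue_const_le:
  assumes "N \<ge> 1"
  shows "lebesgue_const N \<le> 1 + 2 / pi * ln (real N + 1)"
  unfolding lebesgue_const_def using lebesgue_sum_le[OF assms] by (intro cSUP_least) auto

section \<open>Exactness of interpolation and the Lebesgue bound\<close>

lemma cheb_interp_exact:
  assumes N: "N \<ge> 1" and q: "Polynomial.degree q \<le> N"
  shows "poly q x = (\<Sum>\<beta><Suc N. poly q (cheb_node N \<beta>) * poly (cheb_basis N \<beta>) x)"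
proof -
  let ?p = "\<Sum>\<beta><Suc N. Polynomial.smult (poly q (cheb_node N \<beta>)) (cheb_basis N \<beta>)"
  have "q = ?p"
  proof (rule poly_eq_of_cheb_nodes[OF N q])
    show "Polynomial.degree ?p \<le> N"
      by (intro degree_sum_le order.trans[OF degree_smult_le]) (auto simp: degree_cheb_basis[OF N])
    fix \<beta> assume \<beta>: "\<beta> \<le> N"
    have "poly ?p (cheb_node N \<beta>) =
        (\<Sum>\<gamma><Suc N. if \<gamma> = \<beta> then poly q (cheb_node N \<gamma>) else 0)"
      unfolding poly_sum using \<beta> by (intro sum.cong) (auto simp: poly_cheb_basis_node[OF N])
    thus "poly q (cheb_node N \<beta>) = poly ?p (cheb_node N \<beta>)" using \<beta> by simp
  qed
  hence "poly q x = poly ?p x" by (rule arg_cong)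
  thus ?thesis by (simp only: poly_sum poly_smult)
qed

text \<open>The refinement equation of the basis: interpolating $P^\gamma((s+\cdot)/2)$, a polynomial
  of degree $N$, is exact. With $s \in \{0,1\}$ this is multiplication by a middle core.\<close>

lemma poly_cheb_basis_refine:
  assumes N: "N \<ge> 1" and \<gamma>: "\<gamma> < Suc N"
  shows "poly (cheb_basis N \<gamma>) ((s + x) / 2) =
    (\<Sum>\<beta><Suc N. poly (cheb_basis N \<gamma>) ((s + cheb_node N \<beta>) / 2) * poly (cheb_basis N \<beta>) x)"
proof -
  have "Polynomial.degree (pcompose (cheb_basis N \<gamma>) [:s / 2, 1 / 2:]) \<le> N"
    using degree_cheb_basis[OF N, of \<gamma>] \<gamma> by (simp add: degree_pcompose)
  from cheb_interp_exact[OF N this, of x] show ?thesis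
    by (simp add: poly_pcompose add_divide_distrib)
qed

lemma lebesgue_sum_le_const:
  assumes "x \<in> {0..1}"
  shows "(\<Sum>\<alpha><Suc N. \<bar>poly (cheb_basis N \<alpha>) x\<bar>) \<le> lebesgue_const N"
  unfolding lebesgue_const_def atLeast0AtMost lessThan_Suc_atMost[symmetric]
  using cSUP_upper[OF assms bdd_above_lebesgue_sum[of N]]
  by (simp add: atLeast0AtMost lessThan_Suc_atMost)

lemma lebesgue_const_nonneg: "lebesgue_const N \<ge> 0"
  using order.trans[OF sum_nonneg lebesgue_sum_le_const[of 0 N]] by simp

lemma sum_cheb_basis_squares_le:
  assumes "x \<in> {0..1}"
  shows "(\<Sum>\<alpha><Suc N. (poly (cheb_basis N \<alpha>) x)\<^sup>2) \<le> (lebesgue_const N)\<^sup>2"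
proof -
  have "sqrt (\<Sum>\<alpha><Suc N. (poly (cheb_basis N \<alpha>) x)\<^sup>2) \<le> lebesgue_const N"
    using order.trans[OF L2_set_le_sum_abs lebesgue_sum_le_const[OF assms, of N]]
    unfolding L2_set_def .
  thus ?thesis by (simp add: sqrt_le_D)
qed

section \<open>Sums over multi-indices\<close>

lemma sum_PiE_disjoint_Un:
  fixes F :: "('a \<Rightarrow> 'b) \<Rightarrow> real"
  assumes "A \<inter> B = {}"
  shows "(\<Sum>\<sigma>\<in>(A \<union> B) \<rightarrow>\<^sub>E C. F \<sigma>) =
    (\<Sum>\<tau>\<in>B \<rightarrow>\<^sub>E C. \<Sum>\<sigma>\<in>A \<rightarrow>\<^sub>E C. F (\<lambda>k. if k \<in> A then \<sigma> k else \<tau> k))"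
  unfolding sum.cartesian_product
proof (rule sum.reindex_bij_witness[of _ "\<lambda>(\<tau>, \<sigma>). \<lambda>k. if k \<in> A then \<sigma> k else \<tau> k"
      "\<lambda>\<sigma>. (restrict \<sigma> B, restrict \<sigma> A)"])
  fix \<sigma> assume \<sigma>: "\<sigma> \<in> (A \<union> B) \<rightarrow>\<^sub>E C"
  have eq: "(\<lambda>k. if k \<in> A then restrict \<sigma> A k else restrict \<sigma> B k) = \<sigma>"
    using PiE_arb[OF \<sigma>] by (auto simp: fun_eq_iff)
  thus "(case (restrict \<sigma> B, restrict \<sigma> A) of (\<tau>, \<sigma>) \<Rightarrow> \<lambda>k. if k \<in> A then \<sigma> k else \<tau> k) = \<sigma>"
    by simp
  show "(restrict \<sigma> B, restrict \<sigma> A) \<in> (B \<rightarrow>\<^sub>E C) \<times> (A \<rightarrow>\<^sub>E C)"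
    using \<sigma> by auto
  show "(case (restrict \<sigma> B, restrict \<sigma> A) of (\<tau>, \<sigma>) \<Rightarrow> F (\<lambda>k. if k \<in> A then \<sigma> k else \<tau> k)) = F \<sigma>"
    unfolding prod.case eq ..
next
  fix \<omega> assume "\<omega> \<in> (B \<rightarrow>\<^sub>E C) \<times> (A \<rightarrow>\<^sub>E C)"
  then obtain \<tau> \<sigma> where \<omega>: "\<omega> = (\<tau>, \<sigma>)" "\<tau> \<in> B \<rightarrow>\<^sub>E C" "\<sigma> \<in> A \<rightarrow>\<^sub>E C" by blast
  let ?m = "\<lambda>k. if k \<in> A then \<sigma> k else \<tau> k"
  have "?m \<in> (A \<union> B) \<rightarrow>\<^sub>E C"
    using \<omega>(2,3) by (intro PiE_I) (auto dest: PiE_mem PiE_arb)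
  thus "(case \<omega> of (\<tau>, \<sigma>) \<Rightarrow> \<lambda>k. if k \<in> A then \<sigma> k else \<tau> k) \<in> (A \<union> B) \<rightarrow>\<^sub>E C"
    by (simp add: \<omega>(1))
  have "restrict ?m B = restrict \<tau> B" "restrict ?m A = restrict \<sigma> A"
    using assms by (auto simp: restrict_def fun_eq_iff)
  hence "restrict ?m B = \<tau>" "restrict ?m A = \<sigma>"
    using \<omega>(2,3) by (simp_all only: PiE_restrict)
  thus "(restrict (case \<omega> of (\<tau>, \<sigma>) \<Rightarrow> \<lambda>k. if k \<in> A then \<sigma> k else \<tau> k) B,
      restrict (case \<omega> of (\<tau>, \<sigma>) \<Rightarrow> \<lambda>k. if k \<in> A then \<sigma> k else \<tau> k) A) = \<omega>"
    by (simp add: \<omega>(1))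
qed

lemma sum_PiE_Suc:
  fixes F :: "(nat \<Rightarrow> 'b) \<Rightarrow> real"
  shows "(\<Sum>\<sigma>\<in>{1..Suc p} \<rightarrow>\<^sub>E C. F \<sigma>) = (\<Sum>s\<in>C. \<Sum>\<sigma>\<in>{1..p} \<rightarrow>\<^sub>E C. F (\<sigma>(Suc p := s)))"
proof -
  have "{1..Suc p} = insert (Suc p) {1..p}" by auto
  hence "(\<Sum>\<sigma>\<in>{1..Suc p} \<rightarrow>\<^sub>E C. F \<sigma>) =
      sum F ((\<lambda>(s, \<sigma>). \<sigma>(Suc p := s)) ` (C \<times> ({1..p} \<rightarrow>\<^sub>E C)))"
    by (simp only: PiE_insert_eq)
  also have "\<dots> = (\<Sum>(s, \<sigma>)\<in>C \<times> ({1..p} \<rightarrow>\<^sub>E C). F (\<sigma>(Suc p := s)))"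
    using inj_combinator[of "Suc p" "{1..p}" "\<lambda>_. C"]
    by (subst sum.reindex) (auto simp: case_prod_unfold)
  finally show ?thesis by (simp only: sum.cartesian_product)
qed

lemma sum_lessThan_add:
  "sum f {..<m + n} = sum f {..<m} + (\<Sum>i<n. f (m + i))" for f :: "nat \<Rightarrow> real"
  by (induction n) simp_all

lemma sum_two_blocks:
  "(\<Sum>s\<in>{0, 1}. \<Sum>i<r. f (s * r + i)) = sum f {..<2 * r}" for f :: "nat \<Rightarrow> real"
  by (simp add: mult_2 sum_lessThan_add)

section \<open>Matrices with orthonormal columns\<close>

lemma mult_mat_entry:
  assumes "A \<in> carrier_mat m n" "B \<in> carrier_mat n l" "i < m" "j < l"
  shows "(A * B) $$ (i, j) = (\<Sum>k<n. A $$ (i, k) * B $$ (k, j))"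
  using assms by (auto simp: scalar_prod_def lessThan_atLeast0)

lemma orthonormal_cols_iff:
  assumes U: "U \<in> carrier_mat m n"
  shows "orthonormal_cols U \<longleftrightarrow>
    (\<forall>i<n. \<forall>j<n. (\<Sum>k<m. U $$ (k, i) * U $$ (k, j)) = (if i = j then 1 else 0))"
proof -
  have "(transpose_mat U * U) $$ (i, j) = (\<Sum>k<m. U $$ (k, i) * U $$ (k, j))"
    if "i < n" "j < n" for i j
    using mult_mat_entry[of "transpose_mat U" n m U n i j] U that by simp
  thus ?thesis
    using U unfolding orthonormal_cols_def mat_eq_iff by auto
qed

lemma orthonormal_cols_isometry:
  assumes U: "U \<in> carrier_mat m n" and o: "orthonormal_cols U"
  shows "(\<Sum>k<m. (\<Sum>j<n. U $$ (k, j) * g j)\<^sup>2) = (\<Sum>j<n. (g j)\<^sup>2)"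
proof -
  have "(\<Sum>k<m. (\<Sum>j<n. U $$ (k, j) * g j)\<^sup>2) =
      (\<Sum>k<m. \<Sum>i<n. \<Sum>j<n. g i * g j * (U $$ (k, i) * U $$ (k, j)))"
    by (simp add: power2_eq_square sum_product mult_ac)
  also have "\<dots> = (\<Sum>i<n. \<Sum>k<m. \<Sum>j<n. g i * g j * (U $$ (k, i) * U $$ (k, j)))"
    by (rule sum.swap)
  also have "\<dots> = (\<Sum>i<n. \<Sum>j<n. g i * g j * (\<Sum>k<m. U $$ (k, i) * U $$ (k, j)))"
    unfolding sum_distrib_left by (intro sum.cong refl sum.swap)
  also have "\<dots> = (\<Sum>i<n. \<Sum>j<n. if i = j then g i * g j else 0)"
    using o unfolding orthonormal_cols_iff[OF U] by (intro sum.cong refl) auto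
  also have "\<dots> = (\<Sum>j<n. (g j)\<^sup>2)"
    by (simp add: power2_eq_square)
  finally show ?thesis .
qed

lemma is_truncated_svdD:
  assumes "is_truncated_svd B r U D V"
  shows "U \<in> carrier_mat (dim_row B) r" "D \<in> carrier_mat r r" "V \<in> carrier_mat (dim_col B) r"
    and "orthonormal_cols U"
proof -
  from assms obtain U' D' V' where
    r: "r \<le> min (dim_row B) (dim_col B)" and svd: "is_svd B U' D' V'" and
    eq: "U = mat (dim_row B) r (\<lambda>(i, j). U' $$ (i, j))" "D = mat r r (\<lambda>(i, j). D' $$ (i, j))"
      "V = mat (dim_col B) r (\<lambda>(i, j). V' $$ (i, j))"
    unfolding is_truncated_svd_def by blast
  show U: "U \<in> carrier_mat (dim_row B) r" and "D \<in> carrier_mat r r"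
    and "V \<in> carrier_mat (dim_col B) r"
    by (simp_all add: eq)
  have "U' \<in> carrier_mat (dim_row B) (min (dim_row B) (dim_col B))" "orthonormal_cols U'"
    using svd unfolding is_svd_def Let_def by blast+
  hence "\<forall>i<r. \<forall>j<r. (\<Sum>k<dim_row B. U' $$ (k, i) * U' $$ (k, j)) = (if i = j then 1 else 0)"
    using r orthonormal_cols_iff by (meson less_le_trans)
  thus "orthonormal_cols U"
    unfolding orthonormal_cols_iff[OF U] by (simp add: eq)
qed

lemma frob_norm_squared:
  "M \<in> carrier_mat m n \<Longrightarrow> (frob_norm M)\<^sup>2 = (\<Sum>i<m. \<Sum>j<n. (M $$ (i, j))\<^sup>2)"
  by (auto simp: frob_norm_def sum_nonneg)

lemma sum_mat_mult_vec_squares_le: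
  assumes M: "M \<in> carrier_mat m n"
  shows "(\<Sum>i<m. (\<Sum>j<n. M $$ (i, j) * z j)\<^sup>2) \<le> (frob_norm M)\<^sup>2 * (\<Sum>j<n. (z j)\<^sup>2)"
  unfolding frob_norm_squared[OF M] sum_distrib_right
  by (intro sum_mono) (simp add: sum_distrib_right[symmetric] Cauchy_Schwarz_ineq_sum)

section \<open>Products of isometric cores\<close>

lemma step_mat_carrier:
  assumes "R \<in> carrier_mat r (N + 1)"
  shows "step_mat N R \<in> carrier_mat (2 * r) (N + 1)"
proof -
  have "R * core_mid N s \<in> carrier_mat r (N + 1)" for s
    using assms by (simp add: core_mid_def)
  thus ?thesis unfolding step_mat_def mult_2 by (intro carrier_append_rows)
qed

lemma step_mat_entry:
  assumes R: "R \<in> carrier_mat r (N + 1)" and s: "s \<in> {0, 1}" and i: "i < r" and \<beta>: "\<beta> < Suc N"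
  shows "step_mat N R $$ (s * r + i, \<beta>) =
    (\<Sum>\<gamma><Suc N. R $$ (i, \<gamma>) * poly (cheb_basis N \<gamma>) ((real s + cheb_node N \<beta>) / 2))"
proof -
  have C: "core_mid N s \<in> carrier_mat (N + 1) (N + 1)" for s by (simp add: core_mid_def)
  have "(R * core_mid N s) $$ (i, \<beta>) =
      (\<Sum>\<gamma><Suc N. R $$ (i, \<gamma>) * poly (cheb_basis N \<gamma>) ((real s + cheb_node N \<beta>) / 2))"
    using mult_mat_entry[OF R C, of i \<beta>] i \<beta> by (simp add: core_mid_def)
  moreover have "step_mat N R $$ (s * r + i, \<beta>) = (R * core_mid N s) $$ (i, \<beta>)"
    using R C[of 0] C[of 1] s i \<beta> by (auto simp: step_mat_def append_rows_def)
  ultimately show ?thesis by simp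
qed

text \<open>The first $n$ cores have the right shape and orthonormal columns when unfolded; the
  zeroth rank is $1$.\<close>

definition isometric_cores :: "nat \<Rightarrow> (nat \<Rightarrow> nat) \<Rightarrow> (nat \<Rightarrow> real mat) \<Rightarrow> bool" where
  "isometric_cores n r U \<longleftrightarrow> r 0 = 1 \<and>
     (\<forall>k<n. U (Suc k) \<in> carrier_mat (2 * r k) (r (Suc k)) \<and> orthonormal_cols (U (Suc k)))"

lemma core_prod_carrier:
  assumes "isometric_cores n r U" "p \<le> n"
  shows "core_prod r U \<sigma> p \<in> carrier_mat 1 (r p)"
  using assms(2)
proof (induction p)
  case 0
  show ?case using assms(1) by (simp add: isometric_cores_def)
next
  case (Suc p)
  hence "U (Suc p) \<in> carrier_mat (2 * r p) (r (Suc p))"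
    using assms(1) by (simp add: isometric_cores_def)
  hence "core_slice (r p) (U (Suc p)) (\<sigma> (Suc p)) \<in> carrier_mat (r p) (r (Suc p))"
    by (auto simp: core_slice_def)
  thus ?case using Suc by simp
qed

lemma core_prod_Suc_entry:
  assumes c: "isometric_cores n r U" and p: "p < n" and j: "j < r (Suc p)"
  shows "core_prod r U \<sigma> (Suc p) $$ (0, j) =
    (\<Sum>i<r p. core_prod r U \<sigma> p $$ (0, i) * U (Suc p) $$ (\<sigma> (Suc p) * r p + i, j))"
proof -
  have U: "U (Suc p) \<in> carrier_mat (2 * r p) (r (Suc p))"
    using c p by (simp add: isometric_cores_def)
  hence "core_slice (r p) (U (Suc p)) (\<sigma> (Suc p)) \<in> carrier_mat (r p) (r (Suc p))"
    by (auto simp: core_slice_def)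
  from mult_mat_entry[OF core_prod_carrier[OF c less_imp_le[OF p]] this, of 0 j]
  show ?thesis using U j by (simp add: core_slice_def)
qed

lemma core_prod_cong:
  "(\<And>k. k \<in> {1..p} \<Longrightarrow> \<sigma> k = \<tau> k) \<Longrightarrow> core_prod r U \<sigma> p = core_prod r U \<tau> p"
  by (induction p) simp_all

text \<open>The product of the first $p$ cores, read as a $2^p \times r_p$ matrix whose rows are indexed by
  $(\sigma_1,\dots,\sigma_p)$, has orthonormal columns.\<close>

lemma core_prod_isometry:
  assumes c: "isometric_cores n r U" and "p \<le> n"
  shows "(\<Sum>\<sigma>\<in>{1..p} \<rightarrow>\<^sub>E {0, 1}. (\<Sum>i<r p. core_prod r U \<sigma> p $$ (0, i) * g i)\<^sup>2) =
    (\<Sum>i<r p. (g i)\<^sup>2)"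
  using assms(2)
proof (induction p arbitrary: g)
  case 0
  show ?case using c by (simp add: isometric_cores_def)
next
  case (Suc p)
  hence p: "p < n" by simp
  have U: "U (Suc p) \<in> carrier_mat (2 * r p) (r (Suc p))" "orthonormal_cols (U (Suc p))"
    using c p by (auto simp: isometric_cores_def)
  define h where "h = (\<lambda>k. \<Sum>j<r (Suc p). U (Suc p) $$ (k, j) * g j)"
  have step: "(\<Sum>j<r (Suc p). core_prod r U (\<sigma>(Suc p := s)) (Suc p) $$ (0, j) * g j) =
      (\<Sum>i<r p. core_prod r U \<sigma> p $$ (0, i) * h (s * r p + i))" for \<sigma> s
  proof -
    have "core_prod r U (\<sigma>(Suc p := s)) p = core_prod r U \<sigma> p"
      by (rule core_prod_cong) simp
    hence "(\<Sum>j<r (Suc p). core_prod r U (\<sigma>(Suc p := s)) (Suc p) $$ (0, j) * g j) =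
        (\<Sum>j<r (Suc p). \<Sum>i<r p. core_prod r U \<sigma> p $$ (0, i) * U (Suc p) $$ (s * r p + i, j) * g j)"
      using core_prod_Suc_entry[OF c p] by (simp add: sum_distrib_right del: core_prod.simps)
    also have "\<dots> = (\<Sum>i<r p. core_prod r U \<sigma> p $$ (0, i) * h (s * r p + i))"
      unfolding h_def sum_distrib_left by (subst sum.swap) (simp add: mult.assoc)
    finally show ?thesis .
  qed
  have "(\<Sum>\<sigma>\<in>{1..Suc p} \<rightarrow>\<^sub>E {0, 1}. (\<Sum>j<r (Suc p). core_prod r U \<sigma> (Suc p) $$ (0, j) * g j)\<^sup>2) =
      (\<Sum>s\<in>{0, 1}. \<Sum>i<r p. (h (s * r p + i))\<^sup>2)"
    unfolding sum_PiE_Suc step using Suc.IH p by simp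
  also have "\<dots> = (\<Sum>k<2 * r p. (h k)\<^sup>2)"
    by (rule sum_two_blocks)
  also have "\<dots> = (\<Sum>j<r (Suc p). (g j)\<^sup>2)"
    unfolding h_def by (rule orthonormal_cols_isometry[OF U])
  finally show ?case .
qed

section \<open>Replacing the exact cores one by one\<close>

text \<open>The point $\sum_{k>p} 2^{-(k-p)} \sigma_k$ of $[0,1]$ that is encoded by the digits after
  position $p$.\<close>

definition tail_point :: "nat \<Rightarrow> nat \<Rightarrow> (nat \<Rightarrow> nat) \<Rightarrow> real" where
  "tail_point K p \<sigma> = (\<Sum>k=Suc p..K. real (\<sigma> k) / 2 ^ (k - p))"

lemma tail_point_Suc:
  assumes "p < K"
  shows "tail_point K p \<sigma> = (real (\<sigma> (Suc p)) + tail_point K (Suc p) \<sigma>) / 2"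
proof -
  have "tail_point K p \<sigma> = real (\<sigma> (Suc p)) / 2 + (\<Sum>k=Suc (Suc p)..K. real (\<sigma> k) / 2 ^ (k - p))"
    using assms by (simp add: tail_point_def sum.atLeast_Suc_atMost)
  also have "(\<Sum>k=Suc (Suc p)..K. real (\<sigma> k) / 2 ^ (k - p)) = tail_point K (Suc p) \<sigma> / 2"
    unfolding tail_point_def sum_divide_distrib
  proof (intro sum.cong refl)
    fix k assume "k \<in> {Suc (Suc p)..K}"
    hence "k - p = Suc (k - Suc p)" by auto
    thus "real (\<sigma> k) / 2 ^ (k - p) = real (\<sigma> k) / 2 ^ (k - Suc p) / 2" by simp
  qed
  finally show ?thesis by (simp add: add_divide_distrib)
qed

lemma tail_point_mem:
  assumes "p \<le> K" "\<And>k. k \<in> {Suc p..K} \<Longrightarrow> \<sigma> k \<in> {0, 1}"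
  shows "tail_point K p \<sigma> \<in> {0..1}"
  using assms
proof (induction p rule: inc_induct)
  case base
  show ?case by (simp add: tail_point_def)
next
  case (step p)
  have "\<sigma> (Suc p) \<in> {0, 1}" using step by auto
  moreover have "tail_point K (Suc p) \<sigma> \<in> {0..1}" using step by simp
  ultimately show ?case using tail_point_Suc[OF step(2), of \<sigma>] by auto
qed

lemma tail_point_cong:
  "(\<And>k. k \<in> {Suc p..K} \<Longrightarrow> \<sigma> k = \<tau> k) \<Longrightarrow> tail_point K p \<sigma> = tail_point K p \<tau>"
  by (simp add: tail_point_def)

lemma qtt_eq_tail_point: "qtt K f \<sigma> = f (tail_point K 0 \<sigma>)"
  by (simp add: qtt_def tail_point_def)

text \<open>The tensor $U_1(\sigma_1)\cdots U_p(\sigma_p) R_p A(\sigma_{p+1}) \cdots A(\sigma_{K-1})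
  A_R(\sigma_K)$ obtained after $p$ steps of the construction. By the refinement equation, the column vector
  $A(\sigma_{p+1}) \cdots A_R(\sigma_K)$ consists of the values of the basis polynomials at the tail
  point; the definition uses these values in place of the product.\<close>

definition hybrid ::
  "nat \<Rightarrow> nat \<Rightarrow> (nat \<Rightarrow> nat) \<Rightarrow> (nat \<Rightarrow> real mat) \<Rightarrow> (nat \<Rightarrow> real mat) \<Rightarrow> nat \<Rightarrow> (nat \<Rightarrow> nat) \<Rightarrow> real" where
  "hybrid N K r U R p \<sigma> = (\<Sum>i<r p. core_prod r U \<sigma> p $$ (0, i) *
     (\<Sum>\<beta><Suc N. R p $$ (i, \<beta>) * poly (cheb_basis N \<beta>) (tail_point K p \<sigma>)))"

text \<open>Two consecutive hybrid tensors differ by the truncation error of one step, multiplied by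
  an isometry on the left and by a vector of basis polynomial values on the right.\<close>

lemma hybrid_diff:
  assumes N: "N \<ge> 1" and c: "isometric_cores n r U" and p: "p < n" "p < K"
    and R: "R p \<in> carrier_mat (r p) (N + 1)" "R (Suc p) \<in> carrier_mat (r (Suc p)) (N + 1)"
    and s: "\<sigma> (Suc p) \<in> {0, 1}"
  shows "hybrid N K r U R p \<sigma> - hybrid N K r U R (Suc p) \<sigma> =
    (\<Sum>i<r p. core_prod r U \<sigma> p $$ (0, i) * (\<Sum>\<beta><Suc N.
       (step_mat N (R p) - U (Suc p) * R (Suc p)) $$ (\<sigma> (Suc p) * r p + i, \<beta>) *
       poly (cheb_basis N \<beta>) (tail_point K (Suc p) \<sigma>)))"
proof -
  define w where "w = (\<lambda>i. core_prod r U \<sigma> p $$ (0, i))"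
  define s where "s = \<sigma> (Suc p)"
  define z where "z = (\<lambda>\<beta>. poly (cheb_basis N \<beta>) (tail_point K (Suc p) \<sigma>))"
  have s01: "s \<in> {0, 1}" using s by (simp add: s_def)
  have U: "U (Suc p) \<in> carrier_mat (2 * r p) (r (Suc p))"
    using c p by (simp add: isometric_cores_def)
  have row: "s * r p + i < 2 * r p" if "i < r p" for i
    using that s01 by auto
  have "hybrid N K r U R p \<sigma> =
      (\<Sum>i<r p. w i * (\<Sum>\<beta><Suc N. step_mat N (R p) $$ (s * r p + i, \<beta>) * z \<beta>))"
    unfolding hybrid_def w_def
  proof (rule sum.cong[OF refl], rule arg_cong2[of _ _ _ _ "(*)", OF refl])
    fix i assume "i \<in> {..<r p}"
    hence i: "i < r p" by simp
    have "(\<Sum>\<gamma><Suc N. R p $$ (i, \<gamma>) * poly (cheb_basis N \<gamma>) (tail_point K p \<sigma>)) =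
      (\<Sum>\<gamma><Suc N. \<Sum>\<beta><Suc N. R p $$ (i, \<gamma>) *
         poly (cheb_basis N \<gamma>) ((real s + cheb_node N \<beta>) / 2) * z \<beta>)"
      unfolding tail_point_Suc[OF p(2)] s_def[symmetric] z_def
      by (intro sum.cong refl)
         (simp only: lessThan_iff mult.assoc sum_distrib_left
           poly_cheb_basis_refine[OF N, of _ "real s" "tail_point K (Suc p) \<sigma>"])
    also have "\<dots> = (\<Sum>\<beta><Suc N. \<Sum>\<gamma><Suc N. R p $$ (i, \<gamma>) *
         poly (cheb_basis N \<gamma>) ((real s + cheb_node N \<beta>) / 2) * z \<beta>)"
      by (rule sum.swap)
    also have "\<dots> = (\<Sum>\<beta><Suc N. step_mat N (R p) $$ (s * r p + i, \<beta>) * z \<beta>)"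
      by (intro sum.cong refl)
         (simp only: lessThan_iff step_mat_entry[OF R(1) s01 i] sum_distrib_right)
    finally show "(\<Sum>\<gamma><Suc N. R p $$ (i, \<gamma>) * poly (cheb_basis N \<gamma>) (tail_point K p \<sigma>)) = \<dots>" .
  qed
  moreover have "hybrid N K r U R (Suc p) \<sigma> =
      (\<Sum>i<r p. w i * (\<Sum>\<beta><Suc N. (U (Suc p) * R (Suc p)) $$ (s * r p + i, \<beta>) * z \<beta>))"
  proof -
    define g where "g = (\<lambda>j. \<Sum>\<beta><Suc N. R (Suc p) $$ (j, \<beta>) * z \<beta>)"
    have "hybrid N K r U R (Suc p) \<sigma> =
        (\<Sum>j<r (Suc p). (\<Sum>i<r p. w i * U (Suc p) $$ (s * r p + i, j)) * g j)"
      unfolding hybrid_def g_def z_def w_def s_def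
      by (intro sum.cong refl) (simp only: lessThan_iff core_prod_Suc_entry[OF c p(1)])
    also have "\<dots> = (\<Sum>i<r p. \<Sum>j<r (Suc p). w i * (U (Suc p) $$ (s * r p + i, j) * g j))"
      unfolding sum_distrib_right by (subst sum.swap) (simp only: mult.assoc)
    also have "\<dots> = (\<Sum>i<r p. w i * (\<Sum>\<beta><Suc N. (U (Suc p) * R (Suc p)) $$ (s * r p + i, \<beta>) * z \<beta>))"
      unfolding sum_distrib_left[symmetric]
    proof (rule sum.cong[OF refl], rule arg_cong2[of _ _ _ _ "(*)", OF refl])
      fix i assume "i \<in> {..<r p}"
      hence i: "s * r p + i < 2 * r p" using row by simp
      have "(\<Sum>j<r (Suc p). U (Suc p) $$ (s * r p + i, j) * g j) =
          (\<Sum>\<beta><Suc N. \<Sum>j<r (Suc p). U (Suc p) $$ (s * r p + i, j) * R (Suc p) $$ (j, \<beta>) * z \<beta>)"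
        unfolding g_def sum_distrib_left by (subst sum.swap) (simp only: mult.assoc)
      also have "\<dots> = (\<Sum>\<beta><Suc N. (U (Suc p) * R (Suc p)) $$ (s * r p + i, \<beta>) * z \<beta>)"
        using mult_mat_entry[OF U R(2) i]
        by (intro sum.cong refl) (simp add: sum_distrib_right del: sum.lessThan_Suc)
      finally show "(\<Sum>j<r (Suc p). U (Suc p) $$ (s * r p + i, j) * g j) = \<dots>" .
    qed
    finally show ?thesis .
  qed
  moreover have "(step_mat N (R p) - U (Suc p) * R (Suc p)) $$ (s * r p + i, \<beta>) =
      step_mat N (R p) $$ (s * r p + i, \<beta>) - (U (Suc p) * R (Suc p)) $$ (s * r p + i, \<beta>)"
    if "i < r p" "\<beta> < Suc N" for i \<beta>
    using U R(2) row[OF that(1)] that(2) by simp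
  hence "(\<Sum>i<r p. w i * (\<Sum>\<beta><Suc N.
        (step_mat N (R p) - U (Suc p) * R (Suc p)) $$ (s * r p + i, \<beta>) * z \<beta>)) =
      (\<Sum>i<r p. w i * (\<Sum>\<beta><Suc N. step_mat N (R p) $$ (s * r p + i, \<beta>) * z \<beta>)) -
      (\<Sum>i<r p. w i * (\<Sum>\<beta><Suc N. (U (Suc p) * R (Suc p)) $$ (s * r p + i, \<beta>) * z \<beta>))"
    unfolding sum_subtractf[symmetric] right_diff_distrib[symmetric] left_diff_distrib[symmetric]
    by (intro sum.cong refl arg_cong2[of _ _ _ _ "(*)"]) (simp only: lessThan_iff)
  ultimately show ?thesis by (simp only: w_def s_def z_def)
qed

section \<open>Distances in the normalized tensor norm\<close>

lemma tensor_norm_eq_L2_set: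
  "tensor_norm K S = sqrt (1 / 2 ^ K) * L2_set S ({1..K} \<rightarrow>\<^sub>E {0, 1})"
  by (simp only: tensor_norm_def L2_set_def real_sqrt_mult power2_abs)

lemma tensor_norm_triangle:
  "tensor_norm K (\<lambda>\<sigma>. S \<sigma> + T \<sigma>) \<le> tensor_norm K S + tensor_norm K T"
  unfolding tensor_norm_eq_L2_set distrib_left[symmetric]
  by (intro mult_left_mono L2_set_triangle_ineq) simp

lemma tensor_norm_le:
  assumes "(\<Sum>\<sigma>\<in>{1..K} \<rightarrow>\<^sub>E {0, 1}. (S \<sigma>)\<^sup>2) \<le> 2 ^ K * e\<^sup>2" "0 \<le> e"
  shows "tensor_norm K S \<le> e"
proof -
  have "1 / 2 ^ K * (\<Sum>\<sigma>\<in>{1..K} \<rightarrow>\<^sub>E {0, 1}. \<bar>S \<sigma>\<bar>\<^sup>2) \<le> e\<^sup>2"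
    using assms(1) by (simp add: field_simps)
  thus ?thesis unfolding tensor_norm_def using assms(2) by (intro real_le_lsqrt) (auto intro: sum_nonneg)
qed

lemma card_PiE_01: "finite A \<Longrightarrow> card (A \<rightarrow>\<^sub>E {0, 1::nat}) = 2 ^ card A"
  by (simp add: card_PiE card_insert_if numeral_2_eq_2)

lemma tensor_norm_le_sup:
  assumes "\<And>\<sigma>. \<sigma> \<in> {1..K} \<rightarrow>\<^sub>E {0, 1} \<Longrightarrow> \<bar>S \<sigma>\<bar> \<le> e" "0 \<le> e"
  shows "tensor_norm K S \<le> e"
proof (rule tensor_norm_le)
  have "(S \<sigma>)\<^sup>2 \<le> e\<^sup>2" if "\<sigma> \<in> {1..K} \<rightarrow>\<^sub>E {0, 1}" for \<sigma>
    using power_mono[OF assms(1)[OF that], of 2] by simp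
  hence "(\<Sum>\<sigma>\<in>{1..K} \<rightarrow>\<^sub>E {0, 1}. (S \<sigma>)\<^sup>2) \<le> (\<Sum>\<sigma>\<in>{1..K} \<rightarrow>\<^sub>E {0, 1 :: nat}. e\<^sup>2)"
    by (intro sum_mono)
  thus "(\<Sum>\<sigma>\<in>{1..K} \<rightarrow>\<^sub>E {0, 1}. (S \<sigma>)\<^sup>2) \<le> 2 ^ K * e\<^sup>2"
    by (simp only: sum_constant card_PiE_01 finite_atLeastAtMost card_atLeastAtMost
        of_nat_power of_nat_numeral diff_Suc_1)
qed (fact assms(2))

text \<open>One truncation costs $\Lambda_N \varepsilon$. For each choice of the digits after position $p+1$,
  the sum of squares over the first $p+1$ digits is at most the squared Frobenius norm
  of the truncation error, which is at most $\varepsilon^2 2^{p+1}$, times the squared Euclidean norm of the vector of basis values, which is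
  at most $\Lambda_N^2$. There are $2^{K-p-1}$ such choices.\<close>

lemma tensor_norm_hybrid_step:
  assumes N: "N \<ge> 1" and c: "isometric_cores n r U" and p: "p < n" "p < K"
    and R: "R p \<in> carrier_mat (r p) (N + 1)" "R (Suc p) \<in> carrier_mat (r (Suc p)) (N + 1)"
    and err: "frob_norm (step_mat N (R p) - U (Suc p) * R (Suc p)) \<le> \<epsilon> * sqrt (2 ^ Suc p)"
    and \<epsilon>: "\<epsilon> \<ge> 0"
  shows "tensor_norm K (\<lambda>\<sigma>. hybrid N K r U R p \<sigma> - hybrid N K r U R (Suc p) \<sigma>)
    \<le> lebesgue_const N * \<epsilon>"
proof (rule tensor_norm_le)
  define E where "E = step_mat N (R p) - U (Suc p) * R (Suc p)"
  define \<Lambda> where "\<Lambda> = lebesgue_const N"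
  define d where "d = (\<lambda>\<sigma>. hybrid N K r U R p \<sigma> - hybrid N K r U R (Suc p) \<sigma>)"
  define head where "head = {1..Suc p} \<rightarrow>\<^sub>E {0, 1 :: nat}"
  define tail where "tail = {Suc (Suc p)..K} \<rightarrow>\<^sub>E {0, 1 :: nat}"
  define merge where "merge = (\<lambda>\<tau> \<sigma> k. if k \<in> {1..Suc p} then \<sigma> k else \<tau> k :: nat)"
  have "U (Suc p) \<in> carrier_mat (2 * r p) (r (Suc p))"
    using c p by (simp add: isometric_cores_def)
  hence E: "E \<in> carrier_mat (2 * r p) (Suc N)"
    using minus_carrier_mat[OF mult_carrier_mat[OF _ R(2)]] by (simp add: E_def)
  have "0 \<le> frob_norm E" by (simp add: frob_norm_def sum_nonneg)
  hence "(frob_norm E)\<^sup>2 \<le> (\<epsilon> * sqrt (2 ^ Suc p))\<^sup>2"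
    using err unfolding E_def by (intro power_mono)
  hence frob: "(frob_norm E)\<^sup>2 \<le> \<epsilon>\<^sup>2 * 2 ^ Suc p"
    by (simp add: power_mult_distrib)
  have "(\<Sum>\<sigma>\<in>head. (d (merge \<tau> \<sigma>))\<^sup>2) \<le> \<epsilon>\<^sup>2 * 2 ^ Suc p * \<Lambda>\<^sup>2" if \<tau>: "\<tau> \<in> tail" for \<tau>
  proof -
    define z where "z = (\<lambda>\<beta>. poly (cheb_basis N \<beta>) (tail_point K (Suc p) \<tau>))"
    define G where "G = (\<lambda>k. \<Sum>\<beta><Suc N. E $$ (k, \<beta>) * z \<beta>)"
    have d: "d (merge \<tau> (\<sigma>(Suc p := s))) =
        (\<Sum>i<r p. core_prod r U \<sigma> p $$ (0, i) * G (s * r p + i))" if "s \<in> {0, 1}" for \<sigma> s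
    proof -
      let ?\<rho> = "merge \<tau> (\<sigma>(Suc p := s))"
      have "core_prod r U ?\<rho> p = core_prod r U \<sigma> p"
        by (rule core_prod_cong) (simp add: merge_def)
      moreover have "tail_point K (Suc p) ?\<rho> = tail_point K (Suc p) \<tau>"
        by (rule tail_point_cong) (simp add: merge_def)
      moreover have "?\<rho> (Suc p) = s" by (simp add: merge_def)
      ultimately show ?thesis
        using hybrid_diff[where \<sigma> = "merge \<tau> (\<sigma>(Suc p := s))", OF N c p R] that
        by (simp only: d_def G_def z_def E_def)
    qed
    have "(\<Sum>\<sigma>\<in>head. (d (merge \<tau> \<sigma>))\<^sup>2) =
        (\<Sum>s\<in>{0, 1}. \<Sum>\<sigma>\<in>{1..p} \<rightarrow>\<^sub>E {0, 1}.
          (\<Sum>i<r p. core_prod r U \<sigma> p $$ (0, i) * G (s * r p + i))\<^sup>2)"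
      unfolding head_def sum_PiE_Suc by (intro sum.cong refl) (simp only: d)
    also have "\<dots> = (\<Sum>s\<in>{0, 1}. \<Sum>i<r p. (G (s * r p + i))\<^sup>2)"
      using core_prod_isometry[OF c less_imp_le[OF p(1)]] by simp
    also have "\<dots> = (\<Sum>k<2 * r p. (G k)\<^sup>2)"
      by (rule sum_two_blocks)
    also have "\<dots> \<le> (frob_norm E)\<^sup>2 * (\<Sum>\<beta><Suc N. (z \<beta>)\<^sup>2)"
      unfolding G_def by (rule sum_mat_mult_vec_squares_le[OF E])
    also have "\<dots> \<le> \<epsilon>\<^sup>2 * 2 ^ Suc p * \<Lambda>\<^sup>2"
    proof (rule mult_mono[OF frob])
      have "tail_point K (Suc p) \<tau> \<in> {0..1}"
        using p \<tau> by (intro tail_point_mem) (auto simp: tail_def)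
      thus "(\<Sum>\<beta><Suc N. (z \<beta>)\<^sup>2) \<le> \<Lambda>\<^sup>2"
        unfolding z_def \<Lambda>_def by (rule sum_cheb_basis_squares_le)
    qed (simp_all add: sum_nonneg del: sum.lessThan_Suc)
    finally show ?thesis .
  qed
  hence "(\<Sum>\<tau>\<in>tail. \<Sum>\<sigma>\<in>head. (d (merge \<tau> \<sigma>))\<^sup>2) \<le> (\<Sum>\<tau>\<in>tail. \<epsilon>\<^sup>2 * 2 ^ Suc p * \<Lambda>\<^sup>2)"
    by (rule sum_mono)
  also have "\<dots> = 2 ^ (K - Suc p) * (\<epsilon>\<^sup>2 * 2 ^ Suc p * \<Lambda>\<^sup>2)"
    by (simp only: tail_def sum_constant card_PiE_01 finite_atLeastAtMost card_atLeastAtMost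
        of_nat_power of_nat_numeral diff_Suc_Suc)
  also have "\<dots> = 2 ^ (K - Suc p + Suc p) * (\<Lambda> * \<epsilon>)\<^sup>2"
    by (simp only: power_add power_mult_distrib mult_ac)
  also have "K - Suc p + Suc p = K" using p by simp
  finally have "(\<Sum>\<tau>\<in>tail. \<Sum>\<sigma>\<in>head. (d (merge \<tau> \<sigma>))\<^sup>2) \<le> 2 ^ K * (\<Lambda> * \<epsilon>)\<^sup>2" .
  moreover have "{1..K} = {1..Suc p} \<union> {Suc (Suc p)..K}" using p by auto
  hence "(\<Sum>\<sigma>\<in>{1..K} \<rightarrow>\<^sub>E {0, 1}. (d \<sigma>)\<^sup>2) = (\<Sum>\<tau>\<in>tail. \<Sum>\<sigma>\<in>head. (d (merge \<tau> \<sigma>))\<^sup>2)"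
    using sum_PiE_disjoint_Un[of "{1..Suc p}" "{Suc (Suc p)..K}" "\<lambda>\<sigma>. (d \<sigma>)\<^sup>2" "{0, 1}"]
    by (simp add: tail_def head_def merge_def)
  ultimately show "(\<Sum>\<sigma>\<in>{1..K} \<rightarrow>\<^sub>E {0, 1}.
      (hybrid N K r U R p \<sigma> - hybrid N K r U R (Suc p) \<sigma>)\<^sup>2) \<le> 2 ^ K * (lebesgue_const N * \<epsilon>)\<^sup>2"
    by (simp only: d_def \<Lambda>_def)
qed (use \<epsilon> lebesgue_const_nonneg in simp)

text \<open>No truncation happens in the first factorization, so the first hybrid tensor is the
  interpolant of $f$ on the two halves of $[0,1]$.\<close>

lemma hybrid_1:
  assumes N: "N \<ge> 1" and c: "isometric_cores n r U" and n: "0 < n"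
    and R: "R 1 \<in> carrier_mat (r 1) (N + 1)" and L: "core_left N f = U 1 * R 1"
    and s: "\<sigma> 1 \<in> {0, 1}"
  shows "hybrid N K r U R 1 \<sigma> = (\<Sum>\<beta><Suc N. f ((real (\<sigma> 1) + cheb_node N \<beta>) / 2) *
    poly (cheb_basis N \<beta>) (tail_point K 1 \<sigma>))"
proof -
  have U: "U 1 \<in> carrier_mat 2 (r 1)" and r0: "r 0 = 1"
    using c n by (auto simp: isometric_cores_def)
  have w: "core_prod r U \<sigma> 1 $$ (0, i) = U 1 $$ (\<sigma> 1, i)" if "i < r 1" for i
    using core_prod_Suc_entry[OF c n, of i \<sigma>] that c by (simp add: r0)
  have "hybrid N K r U R 1 \<sigma> = (\<Sum>\<beta><Suc N. \<Sum>i<r 1. U 1 $$ (\<sigma> 1, i) * R 1 $$ (i, \<beta>) *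
      poly (cheb_basis N \<beta>) (tail_point K 1 \<sigma>))"
    unfolding hybrid_def sum_distrib_left
    by (subst sum.swap, intro sum.cong refl) (simp only: lessThan_iff w mult.assoc)
  also have "\<dots> = (\<Sum>\<beta><Suc N. (U 1 * R 1) $$ (\<sigma> 1, \<beta>) * poly (cheb_basis N \<beta>) (tail_point K 1 \<sigma>))"
    using mult_mat_entry[OF U R, of "\<sigma> 1"] s
    by (intro sum.cong refl) (auto simp: sum_distrib_right)
  also have "\<dots> = (\<Sum>\<beta><Suc N. f ((real (\<sigma> 1) + cheb_node N \<beta>) / 2) *
      poly (cheb_basis N \<beta>) (tail_point K 1 \<sigma>))"
    unfolding L[symmetric] using s by (intro sum.cong refl) (auto simp: core_left_def)
  finally show ?thesis .
qed

lemma hybrid_last: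
  assumes c: "isometric_cores n r U" and K: "K \<ge> 1" "K - 1 \<le> n"
    and R: "R (K - 1) \<in> carrier_mat (r (K - 1)) (N + 1)"
  shows "hybrid N K r U R (K - 1) \<sigma> = mps_output N K r U R \<sigma>"
proof -
  have X: "core_prod r U \<sigma> (K - 1) \<in> carrier_mat 1 (r (K - 1))"
    by (rule core_prod_carrier[OF c K(2)])
  have C: "core_right N (\<sigma> K) \<in> carrier_mat (N + 1) 1" by (simp add: core_right_def)
  have y: "tail_point K (K - 1) \<sigma> = real (\<sigma> K) / 2"
    using K(1) tail_point_Suc[of "K - 1" K \<sigma>] by (simp add: tail_point_def)
  have "mps_output N K r U R \<sigma> = (\<Sum>\<beta><Suc N. \<Sum>i<r (K - 1).
      core_prod r U \<sigma> (K - 1) $$ (0, i) * R (K - 1) $$ (i, \<beta>) * poly (cheb_basis N \<beta>) (real (\<sigma> K) / 2))"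
    unfolding mps_output_def using mult_mat_entry[OF mult_carrier_mat[OF X R] C, of 0 0]
      mult_mat_entry[OF X R, of 0]
    by (simp add: core_right_def sum_distrib_right del: sum.lessThan_Suc)
  also have "\<dots> = hybrid N K r U R (K - 1) \<sigma>"
    unfolding hybrid_def sum_distrib_left y by (subst sum.swap) (simp only: mult.assoc)
  finally show ?thesis by simp
qed

lemma abs_qtt_diff_le_interp_error:
  assumes K: "K \<ge> 1" and \<sigma>: "\<sigma> \<in> {1..K} \<rightarrow>\<^sub>E {0, 1}"
  shows "ereal \<bar>qtt K f \<sigma> - (\<Sum>\<beta><Suc N. f ((real (\<sigma> 1) + cheb_node N \<beta>) / 2) *
    poly (cheb_basis N \<beta>) (tail_point K 1 \<sigma>))\<bar> \<le> interp_error 1 N f"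
proof -
  let ?u = "real (\<sigma> 1) / 2" and ?v = "tail_point K 1 \<sigma>"
  have "\<sigma> 1 \<in> {0, 1}" using \<sigma> K by auto
  hence "?u \<in> {0..1 - 1 / 2 ^ 1}" by auto
  moreover have "?v \<in> {0..1}" using \<sigma> K by (intro tail_point_mem) auto
  ultimately have "(?u, ?v) \<in> {0..1 - 1 / 2 ^ 1} \<times> {0..1}" by blast
  from SUP_upper[OF this, of "\<lambda>(u, v). ereal \<bar>f (u + v / 2 ^ 1)
       - (\<Sum>\<alpha>=0..N. f (u + cheb_node N \<alpha> / 2 ^ 1) * poly (cheb_basis N \<alpha>) v)\<bar>"]
  have "ereal \<bar>f (?u + ?v / 2 ^ 1)
       - (\<Sum>\<alpha>=0..N. f (?u + cheb_node N \<alpha> / 2 ^ 1) * poly (cheb_basis N \<alpha>) ?v)\<bar> \<le> interp_error 1 N f"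
    unfolding interp_error_def by simp
  moreover have "qtt K f \<sigma> = f (?u + ?v / 2 ^ 1)"
    using tail_point_Suc[of 0 K \<sigma>] K by (simp add: qtt_eq_tail_point add_divide_distrib)
  ultimately show ?thesis
    by (simp add: add_divide_distrib atLeast0AtMost lessThan_Suc_atMost)
qed

section \<open>The error of the construction\<close>

text \<open>Of the minimal truncated singular value decomposition, only the shapes, the orthonormality
  of the left factor and the size of the truncation error matter.\<close>

lemma rank_revealing_cores:
  assumes rr: "rank_revealing \<epsilon> N K f r U R" and K: "K \<ge> 2"
  shows "isometric_cores (K - 1) r U"
    and "\<And>p. p \<in> {1..K - 1} \<Longrightarrow> R p \<in> carrier_mat (r p) (N + 1)"
    and "\<And>p. p \<in> {1..K - 2} \<Longrightarrow>
      frob_norm (step_mat N (R p) - U (Suc p) * R (Suc p)) \<le> \<epsilon> * sqrt (2 ^ Suc p)"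
proof -
  have base: "r 0 = 1" "U 1 \<in> carrier_mat 2 (r 1)" "R 1 \<in> carrier_mat (r 1) (N + 1)"
      "orthonormal_cols (U 1)"
    using rr by (auto simp: rank_revealing_def)
  have step: "U (Suc p) \<in> carrier_mat (2 * r p) (r (Suc p)) \<and> orthonormal_cols (U (Suc p)) \<and>
      R (Suc p) \<in> carrier_mat (r (Suc p)) (N + 1) \<and>
      frob_norm (step_mat N (R p) - U (Suc p) * R (Suc p)) \<le> \<epsilon> * sqrt (2 ^ Suc p)"
    if p: "p \<in> {1..K - 2}" and Rp: "R p \<in> carrier_mat (r p) (N + 1)" for p
  proof -
    have B: "step_mat N (R p) \<in> carrier_mat (2 * r p) (N + 1)"
      by (rule step_mat_carrier[OF Rp])
    from rr p obtain D V where
      svd: "is_truncated_svd (step_mat N (R p)) (r (Suc p)) (U (Suc p)) D V" and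
      err: "frob_norm (step_mat N (R p) - U (Suc p) * D * transpose_mat V) \<le> \<epsilon> * sqrt (2 ^ Suc p)" and
      R': "R (Suc p) = D * transpose_mat V"
      unfolding rank_revealing_def is_minimal_truncated_svd_def Suc_eq_plus1 by blast
    have c: "U (Suc p) \<in> carrier_mat (2 * r p) (r (Suc p))"
      "D \<in> carrier_mat (r (Suc p)) (r (Suc p))" "transpose_mat V \<in> carrier_mat (r (Suc p)) (N + 1)"
      using is_truncated_svdD[OF svd] B by auto
    show ?thesis
      using c err is_truncated_svdD(4)[OF svd] 
      by (simp add: R' assoc_mult_mat[OF c(1,2,3)]
          mult_carrier_mat[OF c(2,3), simplified])
  qed
  show R: "R p \<in> carrier_mat (r p) (N + 1)" if "p \<in> {1..K - 1}" for p
  proof -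
    have "1 \<le> p" "p \<le> K - 1" using that by auto
    thus ?thesis
    proof (induction p rule: nat_induct_at_least)
      case base
      show ?case by (fact \<open>R 1 \<in> carrier_mat (r 1) (N + 1)\<close>)
    next
      case (Suc p)
      thus ?case using step[of p] by simp
    qed
  qed
  show "isometric_cores (K - 1) r U"
    unfolding isometric_cores_def
  proof (intro conjI allI impI)
    fix k assume k: "k < K - 1"
    have "U (Suc k) \<in> carrier_mat (2 * r k) (r (Suc k)) \<and> orthonormal_cols (U (Suc k))"
    proof (cases "k = 0")
      case True
      thus ?thesis using base by simp
    next
      case False
      thus ?thesis using step[of k] R[of k] k by simp
    qed
    thus "U (Suc k) \<in> carrier_mat (2 * r k) (r (Suc k))" "orthonormal_cols (U (Suc k))" by auto
  qed (fact base)
  show "frob_norm (step_mat N (R p) - U (Suc p) * R (Suc p)) \<le> \<epsilon> * sqrt (2 ^ Suc p)"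
    if "p \<in> {1..K - 2}" for p
  proof -
    have "p \<in> {1..K - 1}" using that by auto
    from step[OF that R[OF this]] show ?thesis by blast
  qed
qed

lemma tensor_norm_mps_error:
  assumes \<epsilon>: "\<epsilon> > 0" and N: "N \<ge> 1" and K: "K \<ge> 2" and rr: "rank_revealing \<epsilon> N K f r U R"
  shows "ereal (tensor_norm K (\<lambda>\<sigma>. qtt K f \<sigma> - mps_output N K r U R \<sigma>))
    \<le> interp_error 1 N f + ereal ((real K - 2) * lebesgue_const N * \<epsilon>)"
proof (cases "interp_error 1 N f = \<infinity>")
  case False
  note cores = rank_revealing_cores[OF rr K]
  let ?h = "hybrid N K r U R"
  have pt: "ereal \<bar>qtt K f \<sigma> - ?h 1 \<sigma>\<bar> \<le> interp_error 1 N f"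
    if \<sigma>: "\<sigma> \<in> {1..K} \<rightarrow>\<^sub>E {0, 1}" for \<sigma>
  proof -
    have "\<sigma> 1 \<in> {0, 1}" using \<sigma> K by auto
    moreover have "core_left N f = U 1 * R 1" using rr by (simp add: rank_revealing_def)
    ultimately have "?h 1 \<sigma> = (\<Sum>\<beta><Suc N. f ((real (\<sigma> 1) + cheb_node N \<beta>) / 2) *
        poly (cheb_basis N \<beta>) (tail_point K 1 \<sigma>))"
      using K by (intro hybrid_1[OF N cores(1)] cores(2)) auto
    thus ?thesis using abs_qtt_diff_le_interp_error[OF _ \<sigma>, of f N] K by simp
  qed
  \<comment> \<open>Evaluating at one multi-index shows that the interpolation error is nonnegative; being finite, it is a real number.\<close>
  define \<sigma>\<^sub>0 where "\<sigma>\<^sub>0 = (\<lambda>k\<in>{1..K}. 0 :: nat)"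
  have "\<sigma>\<^sub>0 \<in> {1..K} \<rightarrow>\<^sub>E {0, 1}" by (auto simp: \<sigma>\<^sub>0_def)
  from pt[OF this] have nn: "0 \<le> interp_error 1 N f" by (rule order.trans[rotated]) simp
  then obtain e where e: "interp_error 1 N f = ereal e" "0 \<le> e"
    using False by (cases "interp_error 1 N f") auto
  have T: "tensor_norm K (\<lambda>\<sigma>. qtt K f \<sigma> - ?h 1 \<sigma>) \<le> e"
    using pt e by (intro tensor_norm_le_sup) auto
  have "tensor_norm K (\<lambda>\<sigma>. qtt K f \<sigma> - ?h q \<sigma>) \<le> e + real (q - 1) * (lebesgue_const N * \<epsilon>)"
    if "1 \<le> q" "q \<le> K - 1" for q
    using that
  proof (induction q rule: nat_induct_at_least)
    case base
    show ?case using T by simp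
  next
    case (Suc q)
    have "(\<lambda>\<sigma>. qtt K f \<sigma> - ?h (Suc q) \<sigma>) = (\<lambda>\<sigma>. (qtt K f \<sigma> - ?h q \<sigma>) + (?h q \<sigma> - ?h (Suc q) \<sigma>))"
      by simp
    hence "tensor_norm K (\<lambda>\<sigma>. qtt K f \<sigma> - ?h (Suc q) \<sigma>) \<le>
        tensor_norm K (\<lambda>\<sigma>. qtt K f \<sigma> - ?h q \<sigma>) + tensor_norm K (\<lambda>\<sigma>. ?h q \<sigma> - ?h (Suc q) \<sigma>)"
      using tensor_norm_triangle[of K "\<lambda>\<sigma>. qtt K f \<sigma> - ?h q \<sigma>" "\<lambda>\<sigma>. ?h q \<sigma> - ?h (Suc q) \<sigma>"] by simp
    also have "tensor_norm K (\<lambda>\<sigma>. ?h q \<sigma> - ?h (Suc q) \<sigma>) \<le> lebesgue_const N * \<epsilon>"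
      using Suc.hyps Suc.prems \<epsilon>
      by (intro tensor_norm_hybrid_step[OF N cores(1)] cores(2,3)) auto
    also have "tensor_norm K (\<lambda>\<sigma>. qtt K f \<sigma> - ?h q \<sigma>) \<le> e + real (q - 1) * (lebesgue_const N * \<epsilon>)"
      using Suc by simp
    finally show ?case using Suc.hyps by (simp add: of_nat_diff algebra_simps)
  qed
  from this[of "K - 1"] K
  have "tensor_norm K (\<lambda>\<sigma>. qtt K f \<sigma> - ?h (K - 1) \<sigma>) \<le> e + (real K - 2) * lebesgue_const N * \<epsilon>"
    by (simp add: of_nat_diff mult.assoc)
  moreover have "?h (K - 1) = mps_output N K r U R"
    using K hybrid_last[OF cores(1), of K R N] cores(2)[of "K - 1"] by (intro ext) simp
  ultimately show ?thesis unfolding e by simp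
qed simp

theorem theorem14:
  fixes \<epsilon> :: real and N K :: nat and f :: "real \<Rightarrow> real"
  assumes "\<epsilon> > 0" and "N \<ge> 1" and "K \<ge> 2"
  shows "(\<forall>r U R. rank_revealing \<epsilon> N K f r U R \<longrightarrow>
            ereal (tensor_norm K (\<lambda>\<sigma>. qtt K f \<sigma> - mps_output N K r U R \<sigma>))
              \<le> interp_error 1 N f + ereal ((real K - 2) * lebesgue_const N * \<epsilon>))
         \<and> lebesgue_const N \<le> 1 + 2 / pi * ln (real N + 1)"
  using tensor_norm_mps_error[OF assms] lebesgue_const_le[OF assms(2)] by blast

end
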